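(* Suppose that $\alpha,\beta\in\mathbb{C}\setminus\mathbb{Z}^-$ and $\operatorname{Re}(\alpha+\beta)>-1$. Let $w(z)=K_{\alpha,\beta}[f](z)$ be an $(\alpha,\beta)$-harmonic function defined on $\mathbb{D}$ and satisfying the Dirichlet problem $\Delta_{\alpha,\beta}w=0$ in $\mathbb{D}$, $w=f$ on $\mathbb{T}$, with $f\in L^p(\mathbb{T})$, $1\le p<\infty$. Then for $z=re^{i\theta}\in\mathbb{D}$, the following sharp inequality holds: $$M_p(r,w)\le |c_{\alpha,\beta}|\exp\left(\frac{\pi}{2}|\operatorname{Im}(\alpha-\beta)|\right)F\left(-\frac{\operatorname{Re}(\alpha+\beta)}{2},-\frac{\operatorname{Re}(\alpha+\beta)}{2};1;r^2\right)\|f\|_{L^p(\mathbb{T})}.$$ Moreover, $$M_p(r,w)\le \exp\left(\frac{\pi}{2}|\operatorname{Im}(\alpha-\beta)|\right)B(\alpha,\beta)\,\|f\|_{L^p(\mathbb{T})},\qquad\text{where}\quad B(\alpha,\beta):=\frac{\Gamma(\operatorname{Re}(\alpha+\beta)+1)}{\Gamma^2\left(\frac{\operatorname{Re}(\alpha+\beta)}{2}+1\right)}.$$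
   Context: $\mathbb{D}=\{z\in\mathbb{C}:|z|<1\}$, $\mathbb{T}=\{z\in\mathbb{C}:|z|=1\}$, and $\mathbb{Z}^-$ is the set of negative integers. With $\partial_z=\frac12(\partial_x-i\partial_y)$ and $\partial_{\bar z}=\frac12(\partial_x+i\partial_y)$, set $$\Delta_{\alpha,\beta}=(1-|z|^2)\,\partial_z\partial_{\bar z}+\alpha z\,\partial_z+\beta\bar z\,\partial_{\bar z}-\alpha\beta .$$ A twice continuously differentiable function $w:\mathbb{D}\to\mathbb{C}$ is $(\alpha,\beta)$-harmonic if $\Delta_{\alpha,\beta}w=0$ in $\mathbb{D}$. For continuous $f$ the boundary condition $w=f$ on $\mathbb{T}$ means that $w_r\to f$ in $C(\mathbb{T})$ as $r\to1^-$, where $w_r(e^{i\theta})=w(re^{i\theta})$. Set $c_{\alpha,\beta}=\dfrac{\Gamma(\alpha+1)\Gamma(\beta+1)}{\Gamma(\alpha+\beta+1)}$, $$K_{\alpha,\beta}(z)=c_{\alpha,\beta}\frac{(1-|z|^2)^{\alpha+\beta+1}}{(1-z)^{\alpha+1}(1-\bar z)^{\beta+1}}\quad(z\in\mathbb{D}),\qquad K_{\alpha,\beta}[f](z)=\frac1{2\pi}\int_0^{2\pi}K_{\alpha,\beta}(ze^{-it})f(e^{it})\,dt .$$ The integral mean is $M_p(r,w)=\left(\frac1{2\pi}\int_0^{2\pi}|w(re^{i\theta})|^p\,d\theta\right)^{1/p}$, and $\|f\|_{L^p(\mathbb{T})}=\left(\frac1{2\pi}\int_0^{2\pi}|f(e^{i\theta})|^p\,d\theta\right)^{1/p}$.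 $\Gamma$ is the Gamma function and $F(a,b;c;x)=\sum_{n\ge0}\frac{(a)_n(b)_n}{(c)_n}\frac{x^n}{n!}$ is the Gauss hypergeometric function, with $(a)_0=1$, $(a)_n=a(a+1)\cdots(a+n-1)$.
   Formalization: The second inequality carries the extra factor |c_{α,β}|, since as printed it fails (α=1, β=-1/2, f=1, r=0: 2 > 1.08); "sharp" is read as: equality in the first inequality is attained for all real α=β, every p and r. *)

theory Defs
  imports "HOL-Analysis.Analysis"
begin

definition negative_integers :: "complex set" where
  "negative_integers = of_int ` {..<0}"

text \<open>Directional derivatives of a function on the plane: \<open>v = 1\<close> gives the partial derivative
  in \<open>x\<close>, and \<open>v = \<i>\<close> the one in \<open>y\<close>.\<close>

definition dir_deriv :: "complex \<Rightarrow> (complex \<Rightarrow> complex) \<Rightarrow> complex \<Rightarrow> complex" where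
  "dir_deriv v w z = vector_derivative (\<lambda>t::real. w (z + of_real t * v)) (at 0)"

definition d_z :: "(complex \<Rightarrow> complex) \<Rightarrow> complex \<Rightarrow> complex" where
  "d_z w z = (dir_deriv 1 w z - \<i> * dir_deriv \<i> w z) / 2"

definition d_zbar :: "(complex \<Rightarrow> complex) \<Rightarrow> complex \<Rightarrow> complex" where
  "d_zbar w z = (dir_deriv 1 w z + \<i> * dir_deriv \<i> w z) / 2"

text \<open>Differentiability is over the reals here: \<open>differentiable_on\<close> asks for a real-linear
  derivative.\<close>

definition C1_on :: "complex set \<Rightarrow> (complex \<Rightarrow> complex) \<Rightarrow> bool" where
  "C1_on S w \<longleftrightarrow> w differentiable_on S \<and>
     continuous_on S (dir_deriv 1 w) \<and> continuous_on S (dir_deriv \<i> w)"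

definition C2_on :: "complex set \<Rightarrow> (complex \<Rightarrow> complex) \<Rightarrow> bool" where
  "C2_on S w \<longleftrightarrow> C1_on S w \<and> C1_on S (dir_deriv 1 w) \<and> C1_on S (dir_deriv \<i> w)"

definition Delta_ab ::
    "complex \<Rightarrow> complex \<Rightarrow> (complex \<Rightarrow> complex) \<Rightarrow> complex \<Rightarrow> complex" where
  "Delta_ab \<alpha> \<beta> w z =
     of_real (1 - (cmod z)\<^sup>2) * d_z (d_zbar w) z + \<alpha> * z * d_z w z
       + \<beta> * cnj z * d_zbar w z - \<alpha> * \<beta> * w z"

definition ab_harmonic :: "complex \<Rightarrow> complex \<Rightarrow> (complex \<Rightarrow> complex) \<Rightarrow> bool" where
  "ab_harmonic \<alpha> \<beta> w \<longleftrightarrow> C2_on (ball 0 1) w \<and> (\<forall>z\<in>ball 0 1. Delta_ab \<alpha> \<beta> w z = 0)"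

text \<open>The condition \<open>w = f\<close> on the circle, for continuous \<open>f\<close>: the dilates \<open>w_r\<close> tend to \<open>f\<close>
  uniformly on the circle.\<close>

definition has_boundary_values :: "(complex \<Rightarrow> complex) \<Rightarrow> (complex \<Rightarrow> complex) \<Rightarrow> bool" where
  "has_boundary_values w f \<longleftrightarrow>
     uniform_limit (sphere 0 1) (\<lambda>r \<zeta>. w (of_real r * \<zeta>)) f (at_left (1::real))"

text \<open>For a discontinuous \<open>f\<close> the boundary condition is void; a statement that assumes
  \<open>solves_dirichlet\<close> then covers every way of understanding \<open>w = f\<close> for such \<open>f\<close>.\<close>

definition solves_dirichlet ::
    "complex \<Rightarrow> complex \<Rightarrow> (complex \<Rightarrow> complex) \<Rightarrow> (complex \<Rightarrow> complex) \<Rightarrow> bool" where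
  "solves_dirichlet \<alpha> \<beta> f w \<longleftrightarrow>
     ab_harmonic \<alpha> \<beta> w \<and> (continuous_on (sphere 0 1) f \<longrightarrow> has_boundary_values w f)"

definition c_ab :: "complex \<Rightarrow> complex \<Rightarrow> complex" where
  "c_ab \<alpha> \<beta> = Gamma (\<alpha> + 1) * Gamma (\<beta> + 1) / Gamma (\<alpha> + \<beta> + 1)"

definition K_ab :: "complex \<Rightarrow> complex \<Rightarrow> complex \<Rightarrow> complex" where
  "K_ab \<alpha> \<beta> z = c_ab \<alpha> \<beta> * of_real (1 - (cmod z)\<^sup>2) powr (\<alpha> + \<beta> + 1)
     / ((1 - z) powr (\<alpha> + 1) * (1 - cnj z) powr (\<beta> + 1))"

definition K_transform ::
    "complex \<Rightarrow> complex \<Rightarrow> (complex \<Rightarrow> complex) \<Rightarrow> complex \<Rightarrow> complex" where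
  "K_transform \<alpha> \<beta> f z =
     (LINT t|lebesgue_on {0..2*pi}. K_ab \<alpha> \<beta> (z * cis (- t)) * f (cis t)) / of_real (2 * pi)"

definition in_Lp_circle :: "real \<Rightarrow> (complex \<Rightarrow> complex) \<Rightarrow> bool" where
  "in_Lp_circle p f \<longleftrightarrow>
     (\<lambda>t. f (cis t)) \<in> borel_measurable (lebesgue_on {0..2*pi}) \<and>
     integrable (lebesgue_on {0..2*pi}) (\<lambda>t. cmod (f (cis t)) powr p)"

definition integral_mean :: "real \<Rightarrow> real \<Rightarrow> (complex \<Rightarrow> complex) \<Rightarrow> real" where
  "integral_mean p r w =
     ((LINT t|lebesgue_on {0..2*pi}. cmod (w (of_real r * cis t)) powr p) / (2 * pi)) powr (1 / p)"

definition Lp_norm_circle :: "real \<Rightarrow> (complex \<Rightarrow> complex) \<Rightarrow> real" where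
  "Lp_norm_circle p f =
     ((LINT t|lebesgue_on {0..2*pi}. cmod (f (cis t)) powr p) / (2 * pi)) powr (1 / p)"

definition hyp2F1 :: "real \<Rightarrow> real \<Rightarrow> real \<Rightarrow> real \<Rightarrow> real" where
  "hyp2F1 a b c x =
     (\<Sum>n. pochhammer a n * pochhammer b n / pochhammer c n * x ^ n / fact n)"

text \<open>By Gauss's theorem \<open>B_ab \<alpha> \<beta>\<close> is the value at \<open>x = 1\<close> of \<open>F(-a/2, -a/2; 1; x)\<close>, with
  \<open>a = Re (\<alpha> + \<beta>)\<close>. A bound of the integral means that is uniform in \<open>r\<close> therefore carries
  the factor \<open>cmod (c_ab \<alpha> \<beta>)\<close> besides \<open>B_ab \<alpha> \<beta>\<close>. The factor cannot be dropped: for \<open>\<alpha> = 1\<close>,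
  \<open>\<beta> = -1/2\<close>, \<open>f = 1\<close> the transform is \<open>2 - (cmod z)\<^sup>2\<close>, which is \<open>2\<close> at \<open>0\<close>, while
  \<open>B_ab \<alpha> \<beta> < 1.08\<close>.\<close>

definition B_ab :: "complex \<Rightarrow> complex \<Rightarrow> real" where
  "B_ab \<alpha> \<beta> = Gamma (Re (\<alpha> + \<beta>) + 1) / (Gamma (Re (\<alpha> + \<beta>) / 2 + 1))\<^sup>2"

end

(* Taking moduli in the kernel reduces the problem to the positive kernel
   (1 - |z|^2)^(2s+1) / |1 - z|^(2s+2), where 2s = Re (\<alpha> + \<beta>): the arguments of 1 - z and its
   conjugate are below pi/2 in modulus and cost the factor exp (pi/2 |Im (\<alpha> - \<beta>)|). By Parseval
   the circular mean of this kernel is (1 - r^2)^(2s+1) F(s+1, s+1; 1; r^2), which Euler's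
   transformation turns into F(-s, -s; 1; r^2), and Jensen together with Fubini gives the bound of
   the L^p mean. For the uniform bound, the coefficients of F(s+1, s+1; 1; x) divided by those of
   (1 - x)^(-2s-1) increase to B(\<alpha>, \<beta>). If \<alpha> = \<beta> = s is real, the kernel is positive and f = 1 gives
   equality; its transform is a constant multiple of F(-s, -s; 1; |z|^2), and the hypergeometric
   equation is precisely its harmonicity. *)

theory Submission
  imports Defs
begin

subsection \<open>Hypergeometric series and Euler's transformation\<close>

definition hg_fps :: "real \<Rightarrow> real fps" where
  "hg_fps s = Abs_fps (\<lambda>n. (pochhammer (-s) n / fact n)\<^sup>2)"

text \<open>The hypergeometric equation of \<open>F(-s, -s; 1; x)\<close>; its only other local solution is
  logarithmic at 0, hence the uniqueness among power series below.\<close>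

definition hg_ode :: "real \<Rightarrow> real fps \<Rightarrow> bool" where
  "hg_ode s G \<longleftrightarrow> fps_X * (1 - fps_X) * fps_deriv (fps_deriv G)
     + (1 - fps_const (1 - 2 * s) * fps_X) * fps_deriv G - fps_const (s\<^sup>2) * G = 0"

text \<open>The coefficient of X^n collects n (n + 1) + (n + 1) = (n + 1)^2 in front of the next
  coefficient and n (n - 1) + (1 - 2 s) n + s^2 = (n - s)^2 in front of the current one. The first
  factor never vanishes, so the constant term determines a solution.\<close>

lemma hg_ode_iff:
  "hg_ode s G \<longleftrightarrow> (\<forall>n. (real n + 1)\<^sup>2 * fps_nth G (Suc n) = (real n - s)\<^sup>2 * fps_nth G n)"
proof -
  have "fps_nth (fps_X * (1 - fps_X) * fps_deriv (fps_deriv G)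
     + (1 - fps_const (1 - 2 * s) * fps_X) * fps_deriv G - fps_const (s\<^sup>2) * G) n
     = (real n + 1)\<^sup>2 * fps_nth G (Suc n) - (real n - s)\<^sup>2 * fps_nth G n" for n
  proof -
    have e: "fps_X * (1 - fps_X) * fps_deriv (fps_deriv G)
     + (1 - fps_const (1 - 2 * s) * fps_X) * fps_deriv G - fps_const (s\<^sup>2) * G
     = fps_X * fps_deriv (fps_deriv G) - fps_X * (fps_X * fps_deriv (fps_deriv G)) + fps_deriv G
       - fps_const (1 - 2 * s) * (fps_X * fps_deriv G) - fps_const (s\<^sup>2) * G"
      by (simp only: ring_distribs mult.assoc mult_1_right mult_1_left) (simp add: algebra_simps)
    \<comment> \<open>Multiplication by X twice shifts the index by two, hence the cases 0, 1 and at
      least 2.\<close>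
    show ?thesis unfolding e
      by (cases n rule: nat.exhaust, simp, rename_tac m, case_tac m)
         (simp_all add: algebra_simps power2_eq_square)
  qed
  then show ?thesis
    unfolding hg_ode_def fps_eq_iff by simp
qed

lemma pochhammer_fact_Suc:
  fixes a :: "'a :: field_char_0"
  shows "(of_nat n + 1) * (pochhammer a (Suc n) / fact (Suc n)) = (a + of_nat n) * (pochhammer a n / fact n)"
proof -
  have "(of_nat n + 1 :: 'a) \<noteq> 0" using of_nat_neq_0[of n] by (simp add: add.commute)
  then show ?thesis by (simp add: pochhammer_Suc add.commute mult.commute)
qed

lemma hg_ode_hg_fps: "hg_ode s (hg_fps s)"
proof -
  have "(real n + 1)\<^sup>2 * (pochhammer (-s) (Suc n) / fact (Suc n))\<^sup>2
      = (real n - s)\<^sup>2 * (pochhammer (-s) n / fact n)\<^sup>2" for n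
    unfolding power_mult_distrib[symmetric] pochhammer_fact_Suc by simp
  then show ?thesis unfolding hg_ode_iff hg_fps_def by simp
qed

lemma hg_ode_unique:
  assumes "hg_ode s G" "fps_nth G 0 = 1"
  shows "G = hg_fps s"
proof (rule fps_ext)
  fix n show "fps_nth G n = fps_nth (hg_fps s) n"
  proof (induction n)
    case 0 show ?case using assms by (simp add: hg_fps_def)
  next
    case (Suc n)
    have "(real n + 1)\<^sup>2 * fps_nth G (Suc n) = (real n + 1)\<^sup>2 * fps_nth (hg_fps s) (Suc n)"
      using assms(1) hg_ode_hg_fps[of s] Suc.IH unfolding hg_ode_iff by metis
    then show ?case by (simp add: add_eq_0_iff)
  qed
qed

text \<open>The binomial series of (1 - x)^(-m).\<close>

definition geo_fps :: "real \<Rightarrow> real fps" where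
  "geo_fps m = Abs_fps (\<lambda>n. pochhammer m n / fact n)"

lemma geo_fps_deriv: "(1 - fps_X) * fps_deriv (geo_fps m) = fps_const m * geo_fps m"
proof (rule fps_ext)
  fix n
  define g where "g = fps_nth (geo_fps m)"
  have g: "(real k + 1) * g (Suc k) = (m + real k) * g k" for k
    using pochhammer_fact_Suc[of k m] by (simp add: g_def geo_fps_def)
  have "fps_nth ((1 - fps_X) * fps_deriv (geo_fps m)) n
    = fps_nth (fps_deriv (geo_fps m) - fps_X * fps_deriv (geo_fps m)) n"
    by (simp add: left_diff_distrib)
  also have "\<dots> = (real n + 1) * g (Suc n) - real n * g n"
    unfolding g_def by (cases n) (simp_all add: add.commute)
  also have "\<dots> = m * g n"
    unfolding g by (simp add: algebra_simps)
  finally show "fps_nth ((1 - fps_X) * fps_deriv (geo_fps m)) n = fps_nth (fps_const m * geo_fps m) n"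
    by (simp add: g_def)
qed

text \<open>\<open>B\<close>, \<open>B1\<close>, \<open>B2\<close> and \<open>P\<close>,
  \<open>P1\<close>, \<open>P2\<close> stand for two series with their first two derivatives. The
  bracket is the hypergeometric operator with parameter -S - 1 applied to \<open>B * P\<close>; the
  outer factor \<open>Y\<close> allows the derivatives of \<open>P\<close> to be eliminated without
  division. The proof writes the whole as a combination of the three given relations.\<close>

lemma euler_ode_identity:
  fixes X :: "'a :: comm_ring_1"
  assumes "Y = 1 - X" "m = 2 * S + 1" "Y * P1 = m * P" "Y * P2 = (m + 1) * P1"
    and "X * Y * B2 + (1 - (1 - 2 * S) * X) * B1 - S^2 * B = 0"
  shows "Y * (X * Y * (B2 * P + 2 * B1 * P1 + B * P2)
    + (1 - (3 + 2 * S) * X) * (B1 * P + B * P1) - (S + 1)^2 * (B * P)) = 0" (is "?L = 0")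
proof -
  have "?L = P * Y * (X * Y * B2 + (1 - (1 - 2 * S) * X) * B1 - S^2 * B)
    + (2 * X * Y * B1 + X * B * (m + 1) + (1 - (3 + 2 * S) * X) * B) * (Y * P1 - m * P)
    + X * Y * B * (Y * P2 - (m + 1) * P1)"
    unfolding assms(1,2) by (simp add: algebra_simps power2_eq_square)
  then show ?thesis unfolding assms(3-5) by simp
qed

text \<open>Both sides have constant term 1 and solve the hypergeometric equation with parameter -s
  - 1. For the product this comes out multiplied by 1 - X, which cancels because real formal power
  series form an integral domain.\<close>

lemma euler_transformation_fps:
  "hg_fps (- s - 1) = hg_fps s * geo_fps (2 * s + 1)"
proof -
  define B where "B = hg_fps s"
  define m where "m = fps_const (2 * s + 1)"
  define S where "S = fps_const s"
  define P where "P = geo_fps (2 * s + 1)"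
  define Y where "Y = (1 - fps_X :: real fps)"
  have mS: "m = 2 * S + 1"
    by (simp add: m_def S_def fps_eq_iff fps_numeral_nth)
  have P1: "Y * fps_deriv P = m * P"
    unfolding Y_def P_def m_def by (rule geo_fps_deriv)
  \<comment> \<open>Differentiating once more: Y' = -1 moves one P' to the right and raises m to m +
    1.\<close>
  have "fps_deriv (Y * fps_deriv P) = m * fps_deriv P"
    unfolding P1 by (simp add: m_def)
  then have P2: "Y * fps_deriv (fps_deriv P) = (m + 1) * fps_deriv P"
    by (simp add: Y_def algebra_simps)
  have B: "fps_X * Y * fps_deriv (fps_deriv B) + (1 - (1 - 2 * S) * fps_X) * fps_deriv B - S^2 * B = 0"
  proof -
    have "fps_const (1 - 2 * s) = 1 - 2 * S" "fps_const (s\<^sup>2) = S^2"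
      by (simp_all add: S_def fps_eq_iff fps_numeral_nth fps_const_power)
    then show ?thesis using hg_ode_hg_fps[of s] unfolding hg_ode_def B_def Y_def by simp
  qed
  define G where "G = B * P"
  have c: "fps_const (1 - 2 * (- s - 1)) = 3 + 2 * S" "fps_const ((- s - 1)\<^sup>2) = (S + 1)^2"
    by (simp_all add: S_def fps_eq_iff fps_numeral_nth power2_eq_square algebra_simps)
  have G1: "fps_deriv G = fps_deriv B * P + B * fps_deriv P"
    unfolding G_def by simp
  have G2: "fps_deriv (fps_deriv G) = fps_deriv (fps_deriv B) * P + 2 * fps_deriv B * fps_deriv P + B * fps_deriv (fps_deriv P)"
    unfolding G1 by (simp add: algebra_simps)
  define X where "X = (fps_X :: real fps)"
  have YX: "Y = 1 - X" by (simp add: Y_def X_def)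
  have "Y * (X * Y * fps_deriv (fps_deriv G)
     + (1 - (3 + 2 * S) * X) * fps_deriv G - (S + 1)^2 * G) = 0"
    unfolding G2 unfolding G1 unfolding G_def
    by (rule euler_ode_identity[OF YX mS P1 P2 B[folded X_def]])
  moreover have "Y \<noteq> 0"
    by (auto simp: Y_def fps_eq_iff intro!: exI[of _ 0])
  ultimately have "hg_ode (- s - 1) G"
    unfolding hg_ode_def c X_def Y_def by simp
  then have "G = hg_fps (- s - 1)"
    by (rule hg_ode_unique) (simp add: G_def B_def P_def hg_fps_def geo_fps_def)
  then show ?thesis by (simp add: G_def B_def P_def)
qed

section \<open>Convergence and evaluation of the series in the unit interval\<close>

lemma pochhammer_fact_gbinomial:
  fixes a :: "'a :: field_char_0"
  shows "pochhammer a n / fact n = (- 1) ^ n * ((- a) gchoose n)"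
  by (simp add: gbinomial_pochhammer)

text \<open>Up to sign these are binomial coefficients. Only an inequality holds in general: for
  \<open>a\<close> a nonpositive integer the series terminates.\<close>

lemma conv_radius_pochhammer:
  fixes a :: "'a :: {real_normed_field, banach}"
  shows "conv_radius (\<lambda>n. pochhammer a n / fact n) \<ge> 1"
proof -
  have "conv_radius (\<lambda>n. pochhammer a n / fact n) = conv_radius (\<lambda>n. (- a) gchoose n)"
    unfolding pochhammer_fact_gbinomial
    by (rule conv_radius_cong) (auto simp: norm_mult norm_power)
  then show ?thesis by (simp add: conv_radius_gchoose)
qed

lemma geo_fps_radius: "fps_conv_radius (geo_fps m) \<ge> 1"
  unfolding fps_conv_radius_def geo_fps_def using conv_radius_pochhammer[of m] by simp

text \<open>The terms at r are squares of the terms of a binomial series at sqrt r. The latter are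
  absolutely summable, hence eventually below 1, and then squaring only decreases them.\<close>

lemma hg_fps_radius: "fps_conv_radius (hg_fps s) \<ge> 1"
  unfolding fps_conv_radius_def
proof (rule conv_radius_geI_ex')
  fix r :: real assume r: "0 < r" "ereal r < 1"
  define u where "u n = pochhammer (-s) n / fact n * sqrt r ^ n" for n
  have "summable (\<lambda>n. norm (u n))"
    unfolding u_def using r
    by (intro abs_summable_in_conv_radius less_le_trans[OF _ conv_radius_pochhammer]) auto
  moreover have "norm ((u n)\<^sup>2) \<le> norm (u n)" if "norm (u n) < 1" for n
    using that power_decreasing[of 1 2 "norm (u n)"] by (simp add: norm_power)
  moreover have "eventually (\<lambda>n. norm (u n) < 1) sequentially"
    using summable_LIMSEQ_zero[OF calculation(1)] by (rule order_tendstoD) simp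
  ultimately have "eventually (\<lambda>n. norm ((u n)\<^sup>2) \<le> norm (u n)) sequentially"
    by (auto intro: eventually_mono)
  then have "summable (\<lambda>n. (u n)\<^sup>2)"
    by (rule summable_comparison_test_ev) fact
  moreover have "(u n)\<^sup>2 = fps_nth (hg_fps s) n * of_real r ^ n" for n
  proof -
    have "(sqrt r ^ n)\<^sup>2 = r ^ n"
      using r by (simp add: power_mult flip: power_even_eq)
    then show ?thesis by (simp only: u_def hg_fps_def power_mult_distrib fps_nth_Abs_fps of_real_eq_id id_apply)
  qed
  ultimately show "summable (\<lambda>n. fps_nth (hg_fps s) n * of_real r ^ n)" by simp
qed

lemma geo_sums:
  "\<bar>x\<bar> < 1 \<Longrightarrow> (\<lambda>n. fps_nth (geo_fps m) n * x ^ n) sums eval_fps (geo_fps m) x"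
  by (intro sums_eval_fps less_le_trans[OF _ geo_fps_radius]) simp

lemma hg_sums:
  "\<bar>x\<bar> < 1 \<Longrightarrow> (\<lambda>n. fps_nth (hg_fps s) n * x ^ n) sums eval_fps (hg_fps s) x"
  by (intro sums_eval_fps less_le_trans[OF _ hg_fps_radius]) simp

lemma eval_geo_fps:
  assumes "\<bar>x\<bar> < 1"
  shows "eval_fps (geo_fps m) x = (1 - x) powr (- m)"
proof -
  have "(\<lambda>n. fps_nth (geo_fps m) n * x ^ n) sums (1 - x) powr (- m)"
    using gen_binomial_real[of "- x" "- m"] assms
    by (simp add: geo_fps_def gbinomial_pochhammer mult_ac power_minus[of x])
  then show ?thesis unfolding eval_fps_def by (rule sums_unique[symmetric])
qed

lemma powr_mult_powr_minus:
  "0 < y \<Longrightarrow> y powr m * (c * y powr (- m)) = (c :: real)"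
  by (simp add: powr_minus field_simps)

lemma euler_transformation:
  assumes "\<bar>x\<bar> < 1"
  shows "eval_fps (hg_fps s) x = (1 - x) powr (2 * s + 1) * eval_fps (hg_fps (- s - 1)) x"
proof -
  have x: "ereal (norm x) < 1" using assms by simp
  have "eval_fps (hg_fps (- s - 1)) x = eval_fps (hg_fps s) x * eval_fps (geo_fps (2 * s + 1)) x"
    unfolding euler_transformation_fps using x
    by (intro eval_fps_mult less_le_trans[OF x] hg_fps_radius geo_fps_radius)
  also have "\<dots> = eval_fps (hg_fps s) x * (1 - x) powr (- (2 * s + 1))"
    using assms by (simp add: eval_geo_fps)
  finally show ?thesis
    using assms powr_mult_powr_minus[of "1 - x"] by (simp only:)
qed

lemma hyp2F1_eq_eval: "hyp2F1 (- s) (- s) 1 x = eval_fps (hg_fps s) x"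
  by (simp add: hyp2F1_def eval_fps_def hg_fps_def pochhammer_fact[symmetric] power2_eq_square mult_ac)

section \<open>The value of F(-s, -s; 1; x) at x = 1 as a limit of coefficient ratios\<close>

definition gauss_const :: "real \<Rightarrow> real" where
  "gauss_const s = Gamma (2 * s + 1) / (Gamma (s + 1))\<^sup>2"

text \<open>Consecutive ratios are (s + 1 + n)^2 / ((n + 1) (2 s + 1 + n)), whose numerator exceeds
  the denominator by s^2. The limit is found by recognizing \<open>q n\<close> as a quotient of
  approximants of the Gamma function.\<close>

lemma gauss_const_coeff_ratio:
  fixes s :: real
  assumes s: "s > -1/2"
  defines "q \<equiv> (\<lambda>n. fps_nth (hg_fps (- s - 1)) n / fps_nth (geo_fps (2 * s + 1)) n)"
  shows "incseq q" "q \<longlonglongrightarrow> gauss_const s"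
proof -
  have p1: "pochhammer (s + 1) n > 0" for n using s by (intro pochhammer_pos) auto
  have p2: "pochhammer (2 * s + 1) n > 0" for n using s by (intro pochhammer_pos) auto
  have q: "q n = (pochhammer (s + 1) n)\<^sup>2 / (fact n * pochhammer (2 * s + 1) n)" for n
    by (simp add: q_def hg_fps_def geo_fps_def power2_eq_square add.commute)
  have step: "q (Suc n) = q n * ((s + 1 + real n)\<^sup>2 / ((real n + 1) * (2 * s + 1 + real n)))" for n
    by (simp add: q pochhammer_Suc power_mult_distrib mult_ac add_ac)
  show "incseq q"
  proof (rule incseq_SucI)
    fix n
    have "(real n + 1) * (2 * s + 1 + real n) > 0" using s by (intro mult_pos_pos) auto
    moreover have "(real n + 1) * (2 * s + 1 + real n) \<le> (s + 1 + real n)\<^sup>2"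
      using zero_le_power2[of s] by (simp add: power2_eq_square algebra_simps)
    ultimately have "1 \<le> (s + 1 + real n)\<^sup>2 / ((real n + 1) * (2 * s + 1 + real n))"
      by (simp add: le_divide_eq)
    moreover have "q n > 0" unfolding q using p1[of n] p2[of n] by (intro divide_pos_pos mult_pos_pos zero_less_power) auto
    ultimately show "q n \<le> q (Suc n)" 
      unfolding step by (metis mult.right_neutral mult_le_cancel_left_pos)
  qed
  have e: "Gamma_series' (2 * s + 1) n / (Gamma_series' (s + 1) n)\<^sup>2 = q n" if npos: "n > 0" for n
  proof -
    obtain k where n: "n = Suc k" using npos by (cases n) auto
    define L where "L = ln (real n)"
    \<comment> \<open>\<open>Gamma_series'\<close> carries (n - 1)! while \<open>q\<close> carries
      n!; the surplus power n^(2 (s + 1) - (2 s + 1)) = n makes up for it.\<close>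
    have "exp ((2 * s + 1) * L) * real n = (exp ((s + 1) * L))\<^sup>2"
    proof -
      have "real n = exp L" using npos by (simp add: L_def)
      then have "exp ((2 * s + 1) * L) * real n = exp ((2 * s + 1) * L + L)"
        by (simp add: exp_add)
      also have "\<dots> = (exp ((s + 1) * L))\<^sup>2"
        by (simp add: power2_eq_square flip: exp_add) (simp add: algebra_simps)
      finally show ?thesis .
    qed
    then have E: "(exp ((s + 1) * L))\<^sup>2 = exp ((2 * s + 1) * L) * real n" by simp
    have "Gamma_series' (2 * s + 1) n / (Gamma_series' (s + 1) n)\<^sup>2
      = (fact k * exp ((2 * s + 1) * L) / pochhammer (2 * s + 1) n)
         / ((fact k)\<^sup>2 * (exp ((s + 1) * L))\<^sup>2 / (pochhammer (s + 1) n)\<^sup>2)"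
      unfolding Gamma_series'_def by (simp add: n L_def power_divide power_mult_distrib del: pochhammer_Suc)
    also have "\<dots> = q n"
      unfolding E q using npos p1[of n] p2[of n]
      by (simp add: n field_simps power2_eq_square del: of_nat_Suc)
    finally show ?thesis .
  qed
  have "(\<lambda>n. Gamma_series' (2 * s + 1) n / (Gamma_series' (s + 1) n)\<^sup>2) \<longlonglongrightarrow> gauss_const s"
    unfolding gauss_const_def
  proof (intro tendsto_intros Gamma_series'_LIMSEQ)
    have "Gamma (s + 1) > 0" using s by (intro Gamma_real_pos) auto
    then show "(Gamma (s + 1))\<^sup>2 \<noteq> 0" by simp
  qed
  then show "q \<longlonglongrightarrow> gauss_const s"
    by (rule Lim_transform_eventually) (rule eventually_mono[OF eventually_gt_at_top e])
qed

lemma geo_fps_pos: "s > - 1 / 2 \<Longrightarrow> fps_nth (geo_fps (2 * s + 1)) n > 0"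
  unfolding geo_fps_def by (auto intro!: pochhammer_pos divide_pos_pos)

lemma hg_fps_nth_nonneg: "fps_nth (hg_fps s) n \<ge> 0"
  by (simp add: hg_fps_def)

lemma eval_hg_le_gauss_const:
  assumes s: "s > -1/2" and x: "0 \<le> x" "x < 1"
  shows "eval_fps (hg_fps s) x \<le> gauss_const s"
proof -
  have le: "fps_nth (hg_fps (- s - 1)) n \<le> gauss_const s * fps_nth (geo_fps (2 * s + 1)) n" for n
    using incseq_le[OF gauss_const_coeff_ratio[OF s], of n] geo_fps_pos[OF s, of n]
    by (simp add: divide_le_eq)
  have "eval_fps (hg_fps (- s - 1)) x \<le> gauss_const s * eval_fps (geo_fps (2 * s + 1)) x"
  proof (rule sums_le[OF _ hg_sums sums_mult[OF geo_sums]])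
    show "fps_nth (hg_fps (- s - 1)) n * x ^ n \<le> gauss_const s * (fps_nth (geo_fps (2 * s + 1)) n * x ^ n)" for n
      unfolding mult.assoc[symmetric] using le x by (intro mult_right_mono) auto
  qed (use x in auto)
  then have "eval_fps (hg_fps s) x \<le> (1 - x) powr (2 * s + 1) * (gauss_const s * (1 - x) powr (- (2 * s + 1)))"
    using x by (simp add: euler_transformation[of x s] eval_geo_fps mult_left_mono)
  also have "\<dots> = gauss_const s" using x by (intro powr_mult_powr_minus) simp
  finally show ?thesis .
qed

text \<open>An Abelian argument from below: from some index on the coefficient ratio exceeds b, and
  the finitely many earlier terms cost at most a constant \<open>M\<close>, which the factor (1 -
  x)^(2s+1) annihilates at 1 since its exponent is positive.\<close>

lemma eval_hg_tendsto_gauss_const: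
  assumes s: "s > -1/2"
  shows "(eval_fps (hg_fps s) \<longlongrightarrow> gauss_const s) (at_left 1)"
proof (rule order_tendstoI)
  define g where "g = fps_nth (geo_fps (2 * s + 1))"
  define h where "h = fps_nth (hg_fps (- s - 1))"
  have ev: "eventually (\<lambda>x. 0 < x \<and> x < 1) (at_left (1::real))"
    using eventually_at_left_real[of 0 "1::real"] by simp
  show "eventually (\<lambda>x. eval_fps (hg_fps s) x < a) (at_left 1)" if "gauss_const s < a" for a
    using ev
  proof eventually_elim
    case (elim x)
    then show ?case using that eval_hg_le_gauss_const[OF s, of x] by linarith
  qed
  show "eventually (\<lambda>x. a < eval_fps (hg_fps s) x) (at_left 1)" if a: "a < gauss_const s" for a
  proof -
    obtain b where b: "a < b" "b < gauss_const s" using dense[OF a] by blast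
    have "eventually (\<lambda>n. b < h n / g n) sequentially"
      using order_tendstoD(1)[OF gauss_const_coeff_ratio(2)[OF s] b(2)] by (simp add: h_def g_def)
    then obtain N where N: "\<And>n. n \<ge> N \<Longrightarrow> b < h n / g n" by (auto simp: eventually_sequentially)
    have gpos: "g n > 0" for n unfolding g_def by (rule geo_fps_pos[OF s])
    have hpos: "h n \<ge> 0" for n unfolding h_def by (rule hg_fps_nth_nonneg)
    \<comment> \<open>The absolute value is there because b may be negative, a being arbitrary below
      the limit.\<close>
    define M where "M = (\<Sum>n<N. \<bar>b\<bar> * g n)"
    have low: "b - M * (1 - x) powr (2 * s + 1) \<le> eval_fps (hg_fps s) x" if x: "0 < x" "x < 1" for x
    proof -
      have term_le: "b * (g n * x ^ n) - (if n < N then \<bar>b\<bar> * g n else 0) \<le> h n * x ^ n" for n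
      proof (cases "n < N")
        case True
        have "b * (g n * x ^ n) \<le> \<bar>b\<bar> * (g n * x ^ n)"
          using gpos[of n] x by (intro mult_right_mono) auto
        also have "\<dots> \<le> \<bar>b\<bar> * (g n * 1)"
          using gpos[of n] x by (intro mult_left_mono power_le_one) auto
        also have "\<dots> \<le> \<bar>b\<bar> * g n + h n * x ^ n" using hpos[of n] x by simp
        finally show ?thesis using True by simp
      next
        case False
        then have "b * g n \<le> h n" using N[of n] gpos[of n] by (simp add: less_divide_eq)
        then have "b * g n * x ^ n \<le> h n * x ^ n" using x by (intro mult_right_mono) auto
        then show ?thesis using False by (simp add: mult.assoc)
      qed
      have sM: "(\<lambda>n. if n < N then \<bar>b\<bar> * g n else 0) sums M"
        using sums_If_finite_set[of "{..<N}" "\<lambda>n. \<bar>b\<bar> * g n"] by (simp add: M_def)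
      have "\<bar>x\<bar> < 1" using x by simp
      note sg = geo_sums[OF this, of "2 * s + 1", folded g_def] and sh = hg_sums[OF this, of "- s - 1", folded h_def]
      have "b * eval_fps (geo_fps (2 * s + 1)) x - M \<le> eval_fps (hg_fps (- s - 1)) x"
        by (rule sums_le[OF term_le sums_diff[OF sums_mult[OF sg] sM] sh])
      then have E1: "(1 - x) powr (2 * s + 1) * (b * (1 - x) powr (- (2 * s + 1)) - M)
          \<le> (1 - x) powr (2 * s + 1) * eval_fps (hg_fps (- s - 1)) x"
        using x eval_geo_fps[of x "2 * s + 1"] by (intro mult_left_mono) simp_all
      have E2: "(1 - x) powr (2 * s + 1) * (b * (1 - x) powr (- (2 * s + 1)) - M)
          = b - M * (1 - x) powr (2 * s + 1)"
        using x unfolding right_diff_distrib by (subst powr_mult_powr_minus) auto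
      have E3: "eval_fps (hg_fps s) x = (1 - x) powr (2 * s + 1) * eval_fps (hg_fps (- s - 1)) x"
        using x by (intro euler_transformation) simp
      show ?thesis using E1 unfolding E2 E3 .
    qed
    have "((\<lambda>x. b - M * (1 - x) powr (2 * s + 1)) \<longlongrightarrow> b - M * 0) (at_left 1)"
    proof (intro tendsto_intros)
      have "((\<lambda>x. (1 - x) powr (2 * s + 1)) \<longlongrightarrow> (1 - 1) powr (2 * s + 1)) (at_left (1::real))"
        by (intro tendsto_powr' tendsto_intros disjI2 conjI eventually_mono[OF ev]) (use s in auto)
      then show "((\<lambda>x. (1 - x) powr (2 * s + 1)) \<longlongrightarrow> 0) (at_left (1::real))" by simp
    qed
    then have "eventually (\<lambda>x. a < b - M * (1 - x) powr (2 * s + 1)) (at_left 1)"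
      using b(1) by (intro order_tendstoD) auto
    with ev show ?thesis
    proof eventually_elim
      case (elim x)
      then show ?case using low[of x] by linarith
    qed
  qed
qed

subsection \<open>Circular means of the kernel\<close>

lemma integral_cis_int:
  "((\<lambda>t. cis (of_int k * t)) has_integral (if k = 0 then of_real (2 * pi) else 0)) {0..2*pi}"
proof (cases "k = 0")
  case True
  then show ?thesis using has_integral_const_real[of "1::complex" 0 "2 * pi"] by (simp add: scaleR_conv_of_real)
next
  case False
  let ?F = "\<lambda>t. cis (of_int k * t) / (\<i> * of_int k)"
  have "((\<lambda>t. cis (of_int k * t)) has_integral (?F (2 * pi) - ?F 0)) {0..2*pi}"
  proof (rule fundamental_theorem_of_calculus)
    fix t :: real
    have "((\<lambda>z. exp (\<i> * of_int k * z) / (\<i> * of_int k)) has_field_derivative exp (\<i> * of_int k * of_real t))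
        (at (of_real t))"
      using False by (auto intro!: derivative_eq_intros)
    from has_vector_derivative_real_field[OF this, of "{0..2*pi}"]
    show "(?F has_vector_derivative cis (of_int k * t)) (at t within {0..2*pi})"
      by (simp add: cis_conv_exp mult.assoc)
  qed simp
  moreover have "cis (of_int k * (2 * pi)) = 1"
    by (simp add: complex_eq_iff mult.commute[of _ "2 * pi"] mult.commute[of "of_int k"] sin_int_2pin cos_int_2pin)
  ultimately show ?thesis using False by simp
qed

lemma parseval_finite:
  "(LINT t|lebesgue_on {0..2*pi}. (cmod (\<Sum>n<N. a n * cis (real n * t)))\<^sup>2)
    = 2 * pi * (\<Sum>n<N. (cmod (a n))\<^sup>2)"
proof -
  let ?S = "\<lambda>t. \<Sum>n<N. a n * cis (real n * t)"
  have e: "complex_of_real ((cmod (?S t))\<^sup>2)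
      = (\<Sum>m<N. \<Sum>n<N. a m * cnj (a n) * cis (of_int (int m - int n) * t))" for t
    by (simp add: complex_norm_square sum_product cis_cnj cis_mult left_diff_distrib
        mult.assoc mult.left_commute del: of_real_power)
  have "((\<lambda>t. complex_of_real ((cmod (?S t))\<^sup>2)) has_integral
      (\<Sum>m<N. \<Sum>n<N. a m * cnj (a n) * (if int m - int n = 0 then of_real (2 * pi) else 0))) {0..2*pi}"
    unfolding e by (intro has_integral_sum has_integral_mult_right integral_cis_int) auto
  also have "(\<Sum>m<N. \<Sum>n<N. a m * cnj (a n) * (if int m - int n = 0 then of_real (2 * pi) else 0))
      = complex_of_real (2 * pi * (\<Sum>n<N. (cmod (a n))\<^sup>2))"
    by (simp add: if_distrib[of "(*) _"] sum.delta sum_distrib_left complex_norm_square mult_ac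
        del: of_real_power cong: if_cong)
  finally have "((\<lambda>t. (cmod (?S t))\<^sup>2) has_integral (2 * pi * (\<Sum>n<N. (cmod (a n))\<^sup>2))) {0..2*pi}"
    by (drule_tac has_integral_Re) (simp only: Re_complex_of_real)
  moreover have "continuous_on {0..2*pi} (\<lambda>t. (cmod (?S t))\<^sup>2)"
    unfolding cis_conv_exp by (intro continuous_intros)
  ultimately show ?thesis
    by (subst lebesgue_integral_eq_integral) (auto intro: continuous_imp_integrable_real integral_unique)
qed

text \<open>Absolute summability bounds all partial sums by one constant on the whole circle, so the
  finite case passes to the limit by dominated convergence.\<close>

lemma parseval:
  assumes a: "summable (\<lambda>n. norm (a n))"
  shows "(LINT t|lebesgue_on {0..2*pi}. (cmod (\<Sum>n. a n * cis (real n * t)))\<^sup>2)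
    = 2 * pi * (\<Sum>n. (cmod (a n))\<^sup>2)"
proof -
  let ?M = "lebesgue_on {0..2*pi}"
  let ?S = "\<lambda>N t. \<Sum>n<N. a n * cis (real n * t)"
  have lim: "(\<lambda>N. ?S N t) \<longlonglongrightarrow> (\<Sum>n. a n * cis (real n * t))" for t
    by (rule summable_LIMSEQ, rule summable_norm_cancel) (simp add: norm_mult a)
  have lim2: "(\<lambda>N. (cmod (?S N t))\<^sup>2) \<longlonglongrightarrow> (cmod (\<Sum>n. a n * cis (real n * t)))\<^sup>2" for t
    by (intro tendsto_intros lim)
  have meas: "(\<lambda>t. (cmod (?S N t))\<^sup>2) \<in> borel_measurable ?M" for N
  proof -
    have "continuous_on {0..2*pi} (\<lambda>t. (cmod (?S N t))\<^sup>2)"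
      unfolding cis_conv_exp by (intro continuous_intros)
    then show ?thesis using continuous_imp_integrable_real borel_measurable_integrable by blast
  qed
  have bound: "(cmod (?S N t))\<^sup>2 \<le> (\<Sum>n. norm (a n))\<^sup>2" for N t
  proof (rule power_mono)
    have "cmod (?S N t) \<le> (\<Sum>n<N. norm (a n))"
      by (rule order_trans[OF norm_sum]) (simp add: norm_mult)
    also have "\<dots> \<le> (\<Sum>n. norm (a n))"
      using a by (intro sum_le_suminf) auto
    finally show "cmod (?S N t) \<le> (\<Sum>n. norm (a n))" .
  qed simp
  have "(\<lambda>N. LINT t|?M. (cmod (?S N t))\<^sup>2) \<longlonglongrightarrow> (LINT t|?M. (cmod (\<Sum>n. a n * cis (real n * t)))\<^sup>2)"
  proof (rule integral_dominated_convergence)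
    show "(\<lambda>t. (cmod (\<Sum>n. a n * cis (real n * t)))\<^sup>2) \<in> borel_measurable ?M"
      by (rule borel_measurable_LIMSEQ_metric[OF meas lim2])
    show "integrable ?M (\<lambda>t. (\<Sum>n. norm (a n))\<^sup>2)"
      by (intro continuous_imp_integrable_real continuous_intros)
  qed (use meas lim2 bound in auto)
  moreover have "(\<lambda>N. LINT t|?M. (cmod (?S N t))\<^sup>2) \<longlonglongrightarrow> 2 * pi * (\<Sum>n. (cmod (a n))\<^sup>2)"
    unfolding parseval_finite
  proof (intro tendsto_intros summable_LIMSEQ)
    have "eventually (\<lambda>n. norm (a n) < 1) sequentially"
      using summable_LIMSEQ_zero[OF a] by (rule order_tendstoD) simp
    then have "eventually (\<lambda>n. norm ((cmod (a n))\<^sup>2) \<le> cmod (a n)) sequentially"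
    proof eventually_elim
      case (elim n)
      then show ?case using power_decreasing[of 1 2 "norm (a n)"] by simp
    qed
    then show "summable (\<lambda>n. (cmod (a n))\<^sup>2)"
      by (rule summable_comparison_test_ev) (rule a)
  qed
  ultimately show ?thesis by (rule LIMSEQ_unique)
qed

section \<open>The positive kernel and its circular mean\<close>

definition radial_kernel :: "real \<Rightarrow> complex \<Rightarrow> real" where
  "radial_kernel s u = (1 - (cmod u)\<^sup>2) powr (2 * s + 1) / cmod (1 - u) powr (2 * s + 2)"

lemma radial_kernel_nonneg: "radial_kernel s u \<ge> 0"
  by (simp add: radial_kernel_def)

lemma radial_kernel_cnj: "radial_kernel s (cnj u) = radial_kernel s u"
  unfolding radial_kernel_def by (metis complex_cnj_diff complex_cnj_one complex_mod_cnj)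

lemma radial_kernel_continuous: "continuous_on (ball 0 1) (radial_kernel s)"
  unfolding radial_kernel_def
  by (intro continuous_intros) (auto simp: abs_square_eq_1)

text \<open>The reciprocal of the denominator is the squared modulus of the holomorphic function (1
  - v)^(-(s+1)) at v = u e^(it). Parseval turns its mean into the sum of the squared binomial
  coefficients times |u|^(2n), which is the series \<open>hg_fps (- s - 1)\<close> at |u|^2.\<close>

lemma radial_kernel_mean:
  assumes u: "cmod u < 1"
  shows "(LINT t|lebesgue_on {0..2*pi}. radial_kernel s (u * cis t)) = 2 * pi * eval_fps (hg_fps s) ((cmod u)\<^sup>2)"
proof -
  define c where "c n = (pochhammer (of_real s + 1) n / fact n :: complex)" for n
  define a where "a n = c n * u ^ n" for n
  have c_real: "c n = of_real (pochhammer (s + 1) n / fact n)" for n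
    using pochhammer_of_real[of "s + 1" n, where 'a = complex] by (simp add: c_def)
  have sum_a: "summable (\<lambda>n. norm (a n))"
    unfolding a_def c_def using u
    by (intro abs_summable_in_conv_radius less_le_trans[OF _ conv_radius_pochhammer]) auto
  have square: "cmod (1 - u * cis t) powr (- (2 * s + 2)) = (cmod (\<Sum>n. a n * cis (real n * t)))\<^sup>2" for t
  proof -
    have "(\<lambda>n. a n * cis (real n * t)) sums (1 - u * cis t) powr (- (of_real s + 1))"
      using gen_binomial_complex[of "- (u * cis t)" "- (of_real s + 1)"] u
      by (simp add: a_def c_def gbinomial_pochhammer norm_mult power_minus[of "u * cis t"] power_mult_distrib
          Complex.DeMoivre mult_ac add.commute)
    then have "(\<Sum>n. a n * cis (real n * t)) = (1 - u * cis t) powr (- (of_real s + 1))"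
      by (rule sums_unique[symmetric])
    also have "cmod \<dots> = cmod (1 - u * cis t) powr (- (s + 1))"
      using norm_powr_real_powr'[of "- (of_real s + 1)"] by simp
    finally show ?thesis by (simp add: power2_eq_square flip: powr_add)
  qed
  have k: "radial_kernel s (u * cis t)
      = (1 - (cmod u)\<^sup>2) powr (2 * s + 1) * (cmod (\<Sum>n. a n * cis (real n * t)))\<^sup>2" for t
    unfolding square[symmetric] radial_kernel_def powr_minus by (simp add: norm_mult divide_inverse)
  have "(LINT t|lebesgue_on {0..2*pi}. radial_kernel s (u * cis t))
      = (1 - (cmod u)\<^sup>2) powr (2 * s + 1) * (2 * pi * (\<Sum>n. (cmod (a n))\<^sup>2))"
    unfolding k by (simp add: parseval[OF sum_a])
  also have "(\<Sum>n. (cmod (a n))\<^sup>2) = eval_fps (hg_fps (- s - 1)) ((cmod u)\<^sup>2)"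
    unfolding eval_fps_def
  proof (rule suminf_cong)
    fix n
    have "cmod (a n) = \<bar>pochhammer (s + 1) n / fact n\<bar> * cmod u ^ n"
      unfolding a_def c_real norm_mult norm_of_real norm_power ..
    then show "(cmod (a n))\<^sup>2 = fps_nth (hg_fps (- s - 1)) n * (cmod u)\<^sup>2 ^ n"
      by (simp add: hg_fps_def power_mult_distrib power_divide add.commute mult.commute flip: power_mult)
  qed
  also have "(1 - (cmod u)\<^sup>2) powr (2 * s + 1) * (2 * pi * eval_fps (hg_fps (- s - 1)) ((cmod u)\<^sup>2))
      = 2 * pi * eval_fps (hg_fps s) ((cmod u)\<^sup>2)"
    using u by (subst (2) euler_transformation) (auto simp: abs_square_less_1)
  finally show ?thesis .
qed

subsection \<open>Jensen's inequality for kernels\<close>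

text \<open>Young's inequality with weights 1/p and 1 - 1/p and second factor 1; equivalently, the
  tangent line of x^p at 1 solved for x.\<close>

lemma powr_ge_tangent:
  fixes x p :: real
  assumes "x \<ge> 0" "p \<ge> 1"
  shows "x \<le> x powr p / p + (1 - 1 / p)"
proof (cases "x = 0")
  case True
  then show ?thesis using assms by simp
next
  case False
  then show ?thesis
    using Youngs_inequality_0[of "1 / p" "1 - 1 / p" "x powr p" 1] assms
    by (simp add: powr_powr)
qed

text \<open>Integrates the tangent line of \<open>x powr p\<close> at the mean.\<close>

lemma weighted_jensen:
  fixes k g :: "'a \<Rightarrow> real"
  assumes p: "1 \<le> p" and A: "0 < A" "(\<integral>y. k y \<partial>M) = A"
    and k: "\<And>y. y \<in> space M \<Longrightarrow> 0 \<le> k y" and g: "\<And>y. y \<in> space M \<Longrightarrow> 0 \<le> g y"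
    and int: "integrable M k" "integrable M (\<lambda>y. k y * g y powr p)"
  shows "(\<integral>y. k y * g y \<partial>M) powr p \<le> A powr (p - 1) * (\<integral>y. k y * g y powr p \<partial>M)"
proof -
  define m where "m = (\<integral>y. k y * g y \<partial>M)"
  define G where "G = (\<integral>y. k y * g y powr p \<partial>M)"
  have G0: "G \<ge> 0" unfolding G_def using k by (intro integral_nonneg_AE) auto
  have m0: "m \<ge> 0" unfolding m_def using k g by (intro integral_nonneg_AE) auto
  show ?thesis
  proof (cases "m = 0")
    case True
    then show ?thesis using G0 p by (simp flip: m_def G_def)
  next
    case False
    define \<mu> where "\<mu> = m / A"
    have mu: "\<mu> > 0" using False m0 A by (simp add: \<mu>_def)
    have tangent: "k y * g y \<le> \<mu> * (k y * g y powr p / (\<mu> powr p * p) + (1 - 1 / p) * k y)"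
      if "y \<in> space M" for y
    proof -
      have "g y / \<mu> \<le> (g y / \<mu>) powr p / p + (1 - 1 / p)"
        using g[OF that] mu p by (intro powr_ge_tangent) auto
      then have "k y * \<mu> * (g y / \<mu>) \<le> k y * \<mu> * ((g y / \<mu>) powr p / p + (1 - 1 / p))"
        using k[OF that] mu by (intro mult_left_mono) auto
      then show ?thesis using mu g[OF that] by (simp add: powr_divide algebra_simps)
    qed
    \<comment> \<open>Only the majorant has to be integrable here; if \<open>k y * g y\<close> is
      not, its integral is 0 by convention and the inequality still holds.\<close>
    have "m \<le> (\<integral>y. \<mu> * (k y * g y powr p / (\<mu> powr p * p) + (1 - 1 / p) * k y) \<partial>M)"
      unfolding m_def
    proof (rule integral_mono')
      show "0 \<le> \<mu> * (k y * g y powr p / (\<mu> powr p * p) + (1 - 1 / p) * k y)" if "y \<in> space M" for y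
        using k[OF that] mu p by (intro mult_nonneg_nonneg add_nonneg_nonneg divide_nonneg_nonneg) auto
    qed (use int tangent in auto)
    also have "\<dots> = \<mu> * (G / (\<mu> powr p * p) + (1 - 1 / p) * A)"
      using int by (simp add: A(2) G_def)
    finally have "\<mu> * A \<le> \<mu> * (G / (\<mu> powr p * p) + (1 - 1 / p) * A)"
      using A by (simp add: \<mu>_def)
    then have "A \<le> G / (\<mu> powr p * p) + (1 - 1 / p) * A"
      using mu by (simp only: mult_le_cancel_left_pos)
    then have "A / p \<le> G / (\<mu> powr p * p)" by (simp add: algebra_simps)
    then have "A * \<mu> powr p \<le> G"
      using mu p by (simp add: field_simps)
    then have "A powr (p - 1) * (A * \<mu> powr p) \<le> A powr (p - 1) * G"
      by (intro mult_left_mono) auto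
    also have "A powr (p - 1) * (A * \<mu> powr p) = m powr p"
      using A m0 unfolding \<mu>_def by (simp add: powr_divide powr_diff)
    finally show ?thesis unfolding m_def G_def .
  qed
qed

text \<open>Schur's test with equal marginals: Jensen in the inner variable costs A^(p-1), and
  exchanging the integrals produces the last factor A from the other marginal. \<open>h\<close> is
  merely dominated by the kernel integral, which fits the modulus of a transform with complex
  kernel.\<close>

lemma kernel_Lp_bound:
  fixes k :: "'a \<Rightarrow> 'a \<Rightarrow> real" and g h :: "'a \<Rightarrow> real"
  assumes fin: "finite_measure M" and p: "1 \<le> p" and A: "0 < A"
    and km: "case_prod k \<in> borel_measurable (M \<Otimes>\<^sub>M M)"
    and k: "\<And>x y. x \<in> space M \<Longrightarrow> y \<in> space M \<Longrightarrow> 0 \<le> k x y \<and> k x y \<le> C"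
    and k1: "\<And>x. x \<in> space M \<Longrightarrow> (\<integral>y. k x y \<partial>M) = A"
    and k2: "\<And>y. y \<in> space M \<Longrightarrow> (\<integral>x. k x y \<partial>M) = A"
    and g: "\<And>y. y \<in> space M \<Longrightarrow> 0 \<le> g y" and gp: "integrable M (\<lambda>y. g y powr p)"
    and h: "\<And>x. x \<in> space M \<Longrightarrow> 0 \<le> h x \<and> h x \<le> (\<integral>y. k x y * g y \<partial>M)"
  shows "(\<integral>x. h x powr p \<partial>M) \<le> A powr p * (\<integral>y. g y powr p \<partial>M)"
proof -
  interpret finite_measure M by fact
  interpret pair_sigma_finite M M ..
  note km[measurable]
  have gm[measurable]: "(\<lambda>y. g y powr p) \<in> borel_measurable M" using gp by auto
  have [measurable]: "k x \<in> borel_measurable M" if "x \<in> space M" for x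
    using measurable_compose[OF measurable_Pair1'[OF that] km] by simp
  have ik: "integrable M (k x)" if "x \<in> space M" for x
    using that k[OF that] by (intro integrable_const_bound[where B = C]) auto
  have ikg: "integrable M (\<lambda>y. k x y * g y powr p)" if "x \<in> space M" for x
    using that k[OF that] by (intro Bochner_Integration.integrable_bound[OF integrable_mult_right[OF gp, of C]])
      (auto simp: abs_mult intro!: mult_right_mono order_trans[OF _ abs_ge_self])
  define G where "G x = (\<integral>y. k x y * g y powr p \<partial>M)" for x
  have G0: "G x \<ge> 0" if "x \<in> space M" for x
    unfolding G_def using k[OF that] by (intro integral_nonneg_AE) auto
  have iprod: "integrable (M \<Otimes>\<^sub>M M) (\<lambda>(x, y). g y powr p)"
    by (rule Fubini_integrable) (auto simp: gp)
  have ikprod: "integrable (M \<Otimes>\<^sub>M M) (\<lambda>(x, y). k x y * g y powr p)"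
  proof (rule Bochner_Integration.integrable_bound[OF integrable_mult_right[OF iprod, of C]])
    show "AE z in M \<Otimes>\<^sub>M M. norm (case z of (x, y) \<Rightarrow> k x y * g y powr p)
        \<le> norm (C * (case z of (x, y) \<Rightarrow> g y powr p))"
      using k by (intro AE_I2) (auto simp: space_pair_measure abs_mult intro!: mult_right_mono
          order_trans[OF _ abs_ge_self])
  qed measurable
  have iG: "integrable M G"
    unfolding G_def using integrable_fst'[OF ikprod] by simp
  have "(\<integral>x. h x powr p \<partial>M) \<le> (\<integral>x. A powr (p - 1) * G x \<partial>M)"
  proof (rule integral_mono')
    fix x assume x: "x \<in> space M"
    have "h x powr p \<le> (\<integral>y. k x y * g y \<partial>M) powr p"
      using h[OF x] p by (intro powr_mono2) auto
    also have "\<dots> \<le> A powr (p - 1) * G x"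
      unfolding G_def using k[OF x] g ik[OF x] ikg[OF x] k1[OF x] A p by (intro weighted_jensen) auto
    finally show "h x powr p \<le> A powr (p - 1) * G x" .
  qed (use iG G0 in auto)
  also have "\<dots> = A powr (p - 1) * (\<integral>y. (\<integral>x. k x y * g y powr p \<partial>M) \<partial>M)"
    unfolding G_def using Fubini_integral[OF ikprod] by simp
  also have "(\<integral>y. (\<integral>x. k x y * g y powr p \<partial>M) \<partial>M) = (\<integral>y. A * g y powr p \<partial>M)"
    by (intro Bochner_Integration.integral_cong) (auto simp: k2)
  also have "A powr (p - 1) * (\<integral>y. A * g y powr p \<partial>M) = A powr p * (\<integral>y. g y powr p \<partial>M)"
    using A by (simp add: powr_diff)
  finally show ?thesis .
qed

subsection \<open>The bound for integral means\<close>

text \<open>The logarithms of 1 - z and of its conjugate are conjugate, so Im \<alpha> and Im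
  \<beta> enter with opposite signs and only their difference survives. The modulus is computed
  exactly; the sole loss is in bounding the argument.\<close>

lemma cmod_K_ab_le:
  assumes z: "cmod z < 1"
  shows "cmod (K_ab \<alpha> \<beta> z)
    \<le> cmod (c_ab \<alpha> \<beta>) * exp (pi / 2 * \<bar>Im (\<alpha> - \<beta>)\<bar>) * radial_kernel (Re (\<alpha> + \<beta>) / 2) z"
proof -
  have re: "Re (1 - z) > 0" using z complex_Re_le_cmod[of z] by simp
  then have nz: "1 - z \<noteq> 0" "1 - z \<notin> \<real>\<^sub>\<le>\<^sub>0" by (auto simp: complex_nonpos_Reals_iff)
  define L where "L = Ln (1 - z)"
  have "\<bar>Im L\<bar> < pi / 2" using re Re_Ln_pos_lt[OF nz(1)] unfolding L_def by blast
  then have "\<bar>Im (\<alpha> - \<beta>) * Im L\<bar> \<le> pi / 2 * \<bar>Im (\<alpha> - \<beta>)\<bar>"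
    unfolding abs_mult mult.commute[of "pi / 2"] by (intro mult_left_mono) auto
  then have arg: "Im (\<alpha> - \<beta>) * Im L \<le> pi / 2 * \<bar>Im (\<alpha> - \<beta>)\<bar>" by linarith
  have L: "Re L = ln (cmod (1 - z))" using nz by (simp add: L_def)
  have Lc: "Ln (1 - cnj z) = cnj L" using cnj_Ln[OF nz(2)] by (simp add: L_def)
  have nzc: "1 - cnj z \<noteq> 0" using nz(1) by (metis complex_cnj_cnj complex_cnj_diff complex_cnj_one complex_cnj_zero)
  have den: "cmod ((1 - z) powr (\<alpha> + 1) * (1 - cnj z) powr (\<beta> + 1))
      = cmod (1 - z) powr (Re (\<alpha> + \<beta>) + 2) * exp (- (Im (\<alpha> - \<beta>) * Im L))"
    using nz(1) nzc by (simp add: powr_def Lc L_def[symmetric] L[symmetric] norm_mult flip: exp_add)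
      (simp add: algebra_simps)
  have num: "cmod (of_real (1 - (cmod z)\<^sup>2) powr (\<alpha> + \<beta> + 1)) = (1 - (cmod z)\<^sup>2) powr (Re (\<alpha> + \<beta>) + 1)"
    using z norm_powr_real_powr[of "of_real (1 - (cmod z)\<^sup>2)"] by (simp add: abs_square_le_1 del: of_real_diff)
  have "cmod (K_ab \<alpha> \<beta> z)
      = cmod (c_ab \<alpha> \<beta>) * exp (Im (\<alpha> - \<beta>) * Im L) * radial_kernel (Re (\<alpha> + \<beta>) / 2) z"
  proof -
    have "c * P / (Q * exp (- d)) = c * exp d * (P / Q)" for c P Q d :: real
      by (simp add: exp_minus divide_inverse)
    then show ?thesis
      unfolding K_ab_def norm_divide norm_mult[of "c_ab \<alpha> \<beta>"] num den radial_kernel_def by (simp del: plus_complex.sel)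
  qed
  also have "\<dots> \<le> cmod (c_ab \<alpha> \<beta>) * exp (pi / 2 * \<bar>Im (\<alpha> - \<beta>)\<bar>) * radial_kernel (Re (\<alpha> + \<beta>) / 2) z"
    using arg by (intro mult_right_mono mult_left_mono radial_kernel_nonneg) auto
  finally show ?thesis .
qed

text \<open>A crude bound, uniform in the angle. It secures integrability and does not enter the
  final constant.\<close>

lemma radial_kernel_le:
  assumes "s > -1/2" "cmod u \<le> r" "r < 1"
  shows "radial_kernel s u \<le> 1 / (1 - r) powr (2 * s + 2)"
  unfolding radial_kernel_def
proof (intro frac_le powr_mono2)
  have "(cmod u)\<^sup>2 \<le> 1" using assms by (simp add: power_le_one)
  then show "(1 - (cmod u)\<^sup>2) powr (2 * s + 1) \<le> 1"
    using assms by (intro powr_le1) auto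
  show "1 - r \<le> cmod (1 - u)"
    using norm_triangle_ineq2[of 1 u] assms by simp
qed (use assms in auto)

lemma eval_hg_pos:
  assumes "0 \<le> x" "x < 1"
  shows "eval_fps (hg_fps s) x > 0"
proof -
  have sm: "(\<lambda>n. fps_nth (hg_fps s) n * x ^ n) sums eval_fps (hg_fps s) x"
    using assms by (intro hg_sums) simp
  have "(\<Sum>n<1. fps_nth (hg_fps s) n * x ^ n) \<le> (\<Sum>n. fps_nth (hg_fps s) n * x ^ n)"
    using sums_summable[OF sm] assms by (intro sum_le_suminf) (auto simp: hg_fps_nth_nonneg)
  then show ?thesis using sums_unique[OF sm] by (simp add: hg_fps_def)
qed

lemma K_transform_mean_bound:
  fixes \<alpha> \<beta> :: complex and p r :: real
  defines "s \<equiv> Re (\<alpha> + \<beta>) / 2"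
  defines "C \<equiv> cmod (c_ab \<alpha> \<beta>) * exp (pi / 2 * \<bar>Im (\<alpha> - \<beta>)\<bar>)"
  assumes s: "s > - 1 / 2" and p: "1 \<le> p" and r: "0 \<le> r" "r < 1"
    and f: "in_Lp_circle p f" and w: "\<And>z. z \<in> ball 0 1 \<Longrightarrow> w z = K_transform \<alpha> \<beta> f z"
  shows "integral_mean p r w \<le> C * eval_fps (hg_fps s) (r\<^sup>2) * Lp_norm_circle p f"
proof -
  let ?M = "lebesgue_on {0..2*pi}"
  define k where "k x y = radial_kernel s (of_real r * cis (x - y))" for x y
  define A where "A = 2 * pi * eval_fps (hg_fps s) (r\<^sup>2)"
  \<comment> \<open>All constants go into \<open>g\<close>, so that \<open>k\<close> has the
    marginals \<open>A\<close> and the factor 2 * pi of \<open>A\<close> cancels at the end.\<close>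
  define g where "g y = C / (2 * pi) * cmod (f (cis y))" for y
  define X where "X = (LINT t|?M. cmod (f (cis t)) powr p)"
  have r2: "r\<^sup>2 < 1" using r by (simp add: abs_square_less_1)
  have \<phi>: "eval_fps (hg_fps s) (r\<^sup>2) > 0" using r2 by (intro eval_hg_pos) auto
  have C: "C \<ge> 0" by (simp add: C_def)
  have X: "X \<ge> 0" unfolding X_def by (intro integral_nonneg_AE) auto
  have fp: "integrable ?M (\<lambda>t. cmod (f (cis t)) powr p)" using f by (simp add: in_Lp_circle_def)
  have gp: "g y powr p = (C / (2 * pi)) powr p * cmod (f (cis y)) powr p" for y
    unfolding g_def by (rule powr_mult)
  have kc: "continuous_on UNIV (\<lambda>x. radial_kernel s (of_real r * cis x))"
    unfolding cis_conv_exp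
    by (rule continuous_on_compose2[OF radial_kernel_continuous]) (use r in \<open>auto intro!: continuous_intros simp: norm_mult\<close>)
  define D where "D = 1 / (1 - r) powr (2 * s + 2)"
  have k_bounds: "0 \<le> k x y \<and> k x y \<le> D" for x y
    unfolding k_def D_def using s r by (auto intro!: radial_kernel_nonneg radial_kernel_le simp: norm_mult)
  have "(LINT x|?M. cmod (w (of_real r * cis x)) powr p) \<le> A powr p * (LINT y|?M. g y powr p)"
  proof (rule kernel_Lp_bound[where k = k and C = D])
    show "finite_measure ?M" by (intro finite_measure_lebesgue_on) simp
    show "0 < A" using \<phi> by (simp add: A_def)
    show "case_prod k \<in> borel_measurable (?M \<Otimes>\<^sub>M ?M)"
    proof -
      have id: "(\<lambda>x. x) \<in> borel_measurable ?M"
        using borel_measurable_integrable[OF continuous_imp_integrable_real[OF continuous_on_id]] by simp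
      have "(\<lambda>z. fst z - snd z) \<in> borel_measurable (?M \<Otimes>\<^sub>M ?M)"
        by (intro borel_measurable_diff measurable_compose[OF measurable_fst id] measurable_compose[OF measurable_snd id])
      from measurable_compose[OF this borel_measurable_continuous_onI[OF kc]]
      show ?thesis by (simp add: k_def case_prod_beta')
    qed
    show "0 \<le> k x y \<and> k x y \<le> D" for x y by (rule k_bounds)
    show "(LINT x|?M. k x y) = A" for y
    proof -
      have "k x y = radial_kernel s ((of_real r * cis (- y)) * cis x)" for x
        by (simp add: k_def cis_mult mult.assoc)
      then show ?thesis
        using radial_kernel_mean[of "of_real r * cis (- y)" s] r by (simp add: norm_mult A_def)
    qed
    \<comment> \<open>In the second variable the rotation runs backwards; the invariance of the
      kernel under conjugation turns it round.\<close>
    show "(LINT y|?M. k x y) = A" for x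
    proof -
      have "k x y = radial_kernel s ((of_real r * cis (- x)) * cis y)" for y
        unfolding k_def by (subst radial_kernel_cnj[symmetric]) (simp add: cis_cnj cis_mult mult.assoc)
      then show ?thesis
        using radial_kernel_mean[of "of_real r * cis (- x)" s] r by (simp add: norm_mult A_def)
    qed
    show "integrable ?M (\<lambda>y. g y powr p)" unfolding gp using fp by simp
    show "0 \<le> g y" for y using C by (simp add: g_def)
    show "0 \<le> cmod (w (of_real r * cis x)) \<and> cmod (w (of_real r * cis x)) \<le> (LINT y|?M. k x y * g y)" for x
    proof
      have "cmod (w (of_real r * cis x))
          = cmod (LINT t|?M. K_ab \<alpha> \<beta> (of_real r * cis x * cis (- t)) * f (cis t)) / (2 * pi)"
        using r w[of "of_real r * cis x"] by (simp add: K_transform_def norm_divide norm_mult)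
      also have "\<dots> \<le> (LINT t|?M. cmod (K_ab \<alpha> \<beta> (of_real r * cis x * cis (- t)) * f (cis t))) / (2 * pi)"
        by (intro divide_right_mono integral_norm_bound) auto
      also have "\<dots> \<le> (LINT y|?M. C * k x y * cmod (f (cis y))) / (2 * pi)"
      proof (intro divide_right_mono integral_mono')
        fix t
        have "cmod (K_ab \<alpha> \<beta> (of_real r * cis x * cis (- t))) \<le> C * k x t"
          using cmod_K_ab_le[of "of_real r * cis x * cis (- t)" \<alpha> \<beta>] r
          by (simp add: C_def k_def s_def norm_mult mult.assoc cis_mult)
        then show "cmod (K_ab \<alpha> \<beta> (of_real r * cis x * cis (- t)) * f (cis t)) \<le> C * k x t * cmod (f (cis t))"
          unfolding norm_mult[of _ "f (cis t)"] by (intro mult_right_mono) auto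
        show "0 \<le> C * k x t * cmod (f (cis t))"
          using C by (simp add: k_def radial_kernel_nonneg)
        have "k x \<in> borel_measurable ?M"
        proof -
          have "continuous_on {0..2*pi} (k x)"
            unfolding k_def by (rule continuous_on_compose2[OF kc]) (auto intro!: continuous_intros)
          then show ?thesis by (intro borel_measurable_integrable continuous_imp_integrable_real)
        qed
        moreover have "(\<lambda>y. f (cis y)) \<in> borel_measurable ?M" using f by (simp add: in_Lp_circle_def)
        ultimately have meas: "(\<lambda>y. C * k x y * cmod (f (cis y))) \<in> borel_measurable ?M"
          by (intro borel_measurable_times borel_measurable_norm borel_measurable_const) (simp_all add: measurable_compose_rev)
        \<comment> \<open>On a finite measure space t \<le> 1 + t^p for t \<ge> 0 makes an L^p
          function integrable.\<close>
        have "integrable ?M (\<lambda>y. C * D * (1 + cmod (f (cis y)) powr p))"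
          using fp continuous_imp_integrable_real[OF continuous_on_const, of 0 "2*pi" "1::real"] by simp
        then show "integrable ?M (\<lambda>y. C * k x y * cmod (f (cis y)))"
        proof (rule Bochner_Integration.integrable_bound[OF _ meas], intro AE_I2)
          fix y
          have "cmod (f (cis y)) \<le> 1 + cmod (f (cis y)) powr p"
          proof (cases "cmod (f (cis y)) \<le> 1")
            case False
            then show ?thesis using powr_mono[of 1 p "cmod (f (cis y))"] p by simp
          qed (simp add: add_increasing2)
          then have "C * k x y * cmod (f (cis y)) \<le> C * D * (1 + cmod (f (cis y)) powr p)"
            using C k_bounds[of x y] by (intro mult_mono mult_left_mono) auto
          then show "norm (C * k x y * cmod (f (cis y))) \<le> norm (C * D * (1 + cmod (f (cis y)) powr p))"
            using C k_bounds[of x y] by simp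
        qed
      qed auto
      also have "\<dots> = (LINT y|?M. k x y * g y)"
        by (simp add: g_def mult_ac flip: Bochner_Integration.integral_divide_zero Bochner_Integration.integral_mult_right_zero)
      finally show "cmod (w (of_real r * cis x)) \<le> (LINT y|?M. k x y * g y)" .
    qed simp
  qed (use p in auto)
  also have "\<dots> = (C * eval_fps (hg_fps s) (r\<^sup>2)) powr p * X"
    unfolding gp using C \<phi> by (simp add: A_def X_def powr_mult powr_divide)
  finally have "integral_mean p r w \<le> ((C * eval_fps (hg_fps s) (r\<^sup>2)) powr p * X / (2 * pi)) powr (1 / p)"
    unfolding integral_mean_def using p
    by (intro powr_mono2 divide_right_mono divide_nonneg_nonneg integral_nonneg_AE) auto
  also have "\<dots> = C * eval_fps (hg_fps s) (r\<^sup>2) * Lp_norm_circle p f"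
    unfolding Lp_norm_circle_def X_def[symmetric] times_divide_eq_right[symmetric]
    using C \<phi> X p by (subst powr_mult) (auto simp: powr_powr)
  finally show ?thesis .
qed

subsection \<open>The extremal function\<close>

lemma dir_deriv_eq:
  assumes "(f has_derivative D) (at z)"
  shows "dir_deriv v f z = D v"
  unfolding dir_deriv_def
proof (rule vector_derivative_at)
  have "((\<lambda>t. f (z + of_real t * v)) has_derivative (\<lambda>t. D (of_real t * v))) (at 0)"
    by (rule has_derivative_compose[where f = "\<lambda>t. z + of_real t * v" and g = f])
       (use assms in \<open>auto intro!: derivative_eq_intros\<close>)
  moreover have "D (of_real t * v) = t *\<^sub>R D v" for t
    using linear_scale[OF has_derivative_linear[OF assms], of t v] by (simp add: scaleR_conv_of_real)
  ultimately show "((\<lambda>t. f (z + of_real t * v)) has_vector_derivative D v) (at 0)"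
    unfolding has_vector_derivative_def by simp
qed

lemma C1_onI:
  assumes "\<And>z. z \<in> S \<Longrightarrow> (f has_derivative D z) (at z)"
    and "continuous_on S (\<lambda>z. D z 1)" "continuous_on S (\<lambda>z. D z \<i>)"
  shows "C1_on S f"
  unfolding C1_on_def
proof (intro conjI)
  show "f differentiable_on S"
    unfolding differentiable_on_def differentiable_def
    using assms(1) has_derivative_at_withinI by blast
  show "continuous_on S (dir_deriv 1 f)" "continuous_on S (dir_deriv \<i> f)"
    using assms(2,3) by (simp_all cong: continuous_on_cong add: dir_deriv_eq[OF assms(1)])
qed

text \<open>The affine factor puts a radial function (q = 1, u = 0) and its derivative in direction
  v (series G', q = 0, u = 2 v) into one family, so a single differentiation rule yields C^2
  regularity.\<close>

definition radial_fun :: "real fps \<Rightarrow> real \<Rightarrow> complex \<Rightarrow> complex \<Rightarrow> complex" where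
  "radial_fun G q u z = of_real (eval_fps G ((cmod z)\<^sup>2) * (q + inner z u))"

definition radial_deriv :: "real fps \<Rightarrow> real \<Rightarrow> complex \<Rightarrow> complex \<Rightarrow> complex \<Rightarrow> complex" where
  "radial_deriv G q u z h = of_real (eval_fps (fps_deriv G) ((cmod z)\<^sup>2) * (2 * inner z h) * (q + inner z u)
     + eval_fps G ((cmod z)\<^sup>2) * inner h u)"

lemma in_conv_radius:
  assumes "fps_conv_radius G \<ge> 1" "z \<in> ball 0 1"
  shows "ereal (norm ((cmod z)\<^sup>2)) < fps_conv_radius G"
  by (rule less_le_trans[OF _ assms(1)]) (use assms(2) in \<open>simp add: abs_square_less_1\<close>)

lemma has_derivative_radial_fun:
  assumes G: "fps_conv_radius G \<ge> 1" and z: "z \<in> ball 0 1"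
  shows "(radial_fun G q u has_derivative radial_deriv G q u z) (at z)"
proof -
  have "((\<lambda>z. (cmod z)\<^sup>2) has_derivative (\<lambda>h. 2 * inner z h)) (at z)"
    unfolding power2_norm_eq_inner by (auto intro!: derivative_eq_intros simp: inner_commute)
  then have "((\<lambda>z. eval_fps G ((cmod z)\<^sup>2)) has_derivative
      (\<lambda>h. eval_fps (fps_deriv G) ((cmod z)\<^sup>2) * (2 * inner z h))) (at z)"
    by (rule has_derivative_compose[where f = "\<lambda>z. (cmod z)\<^sup>2" and g = "eval_fps G"])
       (rule has_field_derivative_eval_fps[OF in_conv_radius[OF G z], unfolded has_field_derivative_def])
  note [derivative_intros] = this
  show ?thesis
    unfolding radial_fun_def radial_deriv_def
    by (auto intro!: derivative_eq_intros simp: algebra_simps)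
qed

lemma continuous_on_eval_norm [continuous_intros]:
  "fps_conv_radius G \<ge> 1 \<Longrightarrow> continuous_on (ball 0 1) (\<lambda>z::complex. eval_fps G ((cmod z)\<^sup>2))"
  using in_conv_radius by (intro continuous_on_eval_fps' continuous_intros) (auto simp: eball_def dist_norm)

lemma fps_conv_radius_deriv_ge: "fps_conv_radius (G :: real fps) \<ge> 1 \<Longrightarrow> fps_conv_radius (fps_deriv G) \<ge> 1"
  using fps_conv_radius_deriv[of G] by (rule order_trans[rotated])

lemma C1_on_radial_fun:
  assumes G: "fps_conv_radius G \<ge> 1" and f: "\<And>z. z \<in> ball 0 1 \<Longrightarrow> f z = radial_fun G q u z"
  shows "C1_on (ball 0 1) f"
proof (rule C1_onI)
  show "(f has_derivative radial_deriv G q u z) (at z)" if "z \<in> ball 0 1" for z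
    by (rule has_derivative_transform_within_open[OF has_derivative_radial_fun[OF G that] open_ball that])
       (simp add: f)
  show "continuous_on (ball 0 1) (\<lambda>z. radial_deriv G q u z h)" for h
    unfolding radial_deriv_def by (intro continuous_intros G fps_conv_radius_deriv_ge)
  then show "continuous_on (ball 0 1) (\<lambda>z. radial_deriv G q u z h)" for h .
qed

lemma dir_deriv_radial:
  assumes "fps_conv_radius G \<ge> 1" "z \<in> ball 0 1"
  shows "dir_deriv v (radial_fun G 1 0) z = radial_fun (fps_deriv G) 0 (2 * v) z"
  using dir_deriv_eq[OF has_derivative_radial_fun[OF assms]]
  by (simp add: radial_deriv_def radial_fun_def inner_mult_right inner_complex_def algebra_simps)

lemma C2_on_radial:
  assumes G: "fps_conv_radius G \<ge> 1"
  shows "C2_on (ball 0 1) (radial_fun G 1 0)"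
  unfolding C2_on_def
  using C1_on_radial_fun[OF G] C1_on_radial_fun[OF fps_conv_radius_deriv_ge[OF G] dir_deriv_radial[OF G]]
  by blast

lemma d_zbar_radial:
  assumes "fps_conv_radius G \<ge> 1" "z \<in> ball 0 1"
  shows "d_zbar (radial_fun G 1 0) z = of_real (eval_fps (fps_deriv G) ((cmod z)\<^sup>2)) * z"
    and "d_z (radial_fun G 1 0) z = of_real (eval_fps (fps_deriv G) ((cmod z)\<^sup>2)) * cnj z"
  unfolding d_zbar_def d_z_def dir_deriv_radial[OF assms]
  by (simp_all add: radial_fun_def inner_complex_def complex_eq_iff)

lemma d_z_d_zbar_radial:
  assumes G: "fps_conv_radius G \<ge> 1" and z: "z \<in> ball 0 1"
  defines "x \<equiv> (cmod z)\<^sup>2"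
  shows "d_z (d_zbar (radial_fun G 1 0)) z
    = of_real (eval_fps (fps_deriv G) x + x * eval_fps (fps_deriv (fps_deriv G)) x)"
proof -
  let ?G = "fps_deriv G"
  note G1 = fps_conv_radius_deriv_ge[OF G]
  \<comment> \<open>The function G'(|z|^2) z split into real and imaginary part: the inner products
    of z with 1 and with the imaginary unit are Re z and Im z.\<close>
  have "((\<lambda>z. radial_fun ?G 0 1 z + \<i> * radial_fun ?G 0 \<i> z) has_derivative
      (\<lambda>h. radial_deriv ?G 0 1 z h + \<i> * radial_deriv ?G 0 \<i> z h)) (at z)"
    by (intro has_derivative_add has_derivative_mult_right has_derivative_radial_fun G1 z)
  then have "(d_zbar (radial_fun G 1 0) has_derivative
      (\<lambda>h. radial_deriv ?G 0 1 z h + \<i> * radial_deriv ?G 0 \<i> z h)) (at z)"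
    by (rule has_derivative_transform_within_open[OF _ open_ball z])
       (simp add: d_zbar_radial[OF G] radial_fun_def inner_complex_def complex_eq_iff)
  from dir_deriv_eq[OF this]
  have "d_z (d_zbar (radial_fun G 1 0)) z
     = ((radial_deriv ?G 0 1 z 1 + \<i> * radial_deriv ?G 0 \<i> z 1)
       - \<i> * (radial_deriv ?G 0 1 z \<i> + \<i> * radial_deriv ?G 0 \<i> z \<i>)) / 2"
    unfolding d_z_def by simp
  also have "\<dots> = of_real (eval_fps ?G x + x * eval_fps (fps_deriv ?G) x)"
    by (simp add: radial_deriv_def x_def cmod_power2 inner_complex_def complex_eq_iff)
       (simp add: field_simps power2_eq_square)
  finally show ?thesis .
qed

lemma conv_radius_closed:
  fixes f g :: "real fps"
  assumes "1 \<le> fps_conv_radius f" "1 \<le> fps_conv_radius g"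
  shows "1 \<le> fps_conv_radius (f * g)" "1 \<le> fps_conv_radius (f + g)" "1 \<le> fps_conv_radius (f - g)"
  using order_trans[OF _ fps_conv_radius_mult, of 1 f g] order_trans[OF _ fps_conv_radius_add, of 1 f g]
    order_trans[OF _ fps_conv_radius_diff, of 1 f g] assms by simp_all

lemma hg_ode_eval:
  assumes ode: "hg_ode s G" and G: "1 \<le> fps_conv_radius G" and x: "\<bar>x\<bar> < 1"
  shows "x * (1 - x) * eval_fps (fps_deriv (fps_deriv G)) x
     + (1 - (1 - 2 * s) * x) * eval_fps (fps_deriv G) x - s\<^sup>2 * eval_fps G x = 0"
proof -
  have r: "ereal (norm x) < fps_conv_radius f" if "1 \<le> fps_conv_radius f" for f :: "real fps"
    by (rule less_le_trans[OF _ that]) (use x in simp)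
  have ev: "eval_fps (f * g) x = eval_fps f x * eval_fps g x" "eval_fps (f + g) x = eval_fps f x + eval_fps g x"
      "eval_fps (f - g) x = eval_fps f x - eval_fps g x"
    if "1 \<le> fps_conv_radius f" "1 \<le> fps_conv_radius g" for f g :: "real fps"
    using r[OF that(1)] r[OF that(2)] by (rule eval_fps_mult eval_fps_add eval_fps_diff)+
  have "eval_fps (fps_X * (1 - fps_X) * fps_deriv (fps_deriv G)
     + (1 - fps_const (1 - 2 * s) * fps_X) * fps_deriv G - fps_const (s\<^sup>2) * G) x = 0"
    using ode unfolding hg_ode_def by simp
  then show ?thesis
    by (simp only: ev conv_radius_closed fps_conv_radius_deriv_ge G fps_conv_radius_const fps_conv_radius_1
        fps_conv_radius_fps_X ereal_less_eq eval_fps_const eval_fps_1 eval_fps_X simp_thms)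
qed

text \<open>With x = |z|^2 each first-order term contributes s x G', so the operator becomes (1 - x)
  (G' + x G'') + 2 s x G' - s^2 G, the hypergeometric expression regrouped.\<close>

lemma ab_harmonic_radial:
  assumes ode: "hg_ode s G" and G: "1 \<le> fps_conv_radius G"
  shows "ab_harmonic (of_real s) (of_real s) (radial_fun G 1 0)"
  unfolding ab_harmonic_def
proof (intro conjI ballI C2_on_radial G)
  fix z :: complex assume z: "z \<in> ball 0 1"
  define x where "x = (cmod z)\<^sup>2"
  have x: "\<bar>x\<bar> < 1" using z by (simp add: x_def abs_square_less_1)
  have zz: "z * cnj z = of_real x" unfolding x_def by (rule complex_norm_square[symmetric])
  have "Delta_ab (of_real s) (of_real s) (radial_fun G 1 0) z
    = of_real ((1 - x) * (eval_fps (fps_deriv G) x + x * eval_fps (fps_deriv (fps_deriv G)) x))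
      + of_real (2 * s * eval_fps (fps_deriv G) x) * (z * cnj z) - of_real (s * s * eval_fps G x)"
    unfolding Delta_ab_def d_z_d_zbar_radial[OF G z] d_zbar_radial[OF G z]
    by (simp add: radial_fun_def x_def[symmetric] mult_ac)
  also have "\<dots> = of_real (x * (1 - x) * eval_fps (fps_deriv (fps_deriv G)) x
     + (1 - (1 - 2 * s) * x) * eval_fps (fps_deriv G) x - s\<^sup>2 * eval_fps G x)"
    unfolding zz of_real_mult[symmetric] of_real_add[symmetric] of_real_diff[symmetric] of_real_eq_iff
    by (simp add: algebra_simps power2_eq_square)
  also have "\<dots> = 0" using hg_ode_eval[OF ode G x] by simp
  finally show "Delta_ab (of_real s) (of_real s) (radial_fun G 1 0) z = 0" .
qed

text \<open>For equal real parameters the two factors of the denominator are conjugate, so passing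
  to the modulus of the kernel loses nothing.\<close>

lemma K_ab_real:
  assumes z: "cmod z < 1"
  shows "K_ab (of_real s) (of_real s) z = c_ab (of_real s) (of_real s) * of_real (radial_kernel s z)"
proof -
  have re: "Re (1 - z) > 0" using z complex_Re_le_cmod[of z] by simp
  have "(1 - cnj z) powr (of_real s + 1) = cnj ((1 - z) powr (of_real s + 1))"
    using cnj_powr[of "1 - z" "of_real s + 1"] re by simp
  then have "(1 - z) powr (of_real s + 1) * (1 - cnj z) powr (of_real s + 1)
      = of_real ((cmod ((1 - z) powr (of_real s + 1)))\<^sup>2)"
    by (simp only: complex_norm_square)
  also have "cmod ((1 - z) powr (of_real s + 1)) = cmod (1 - z) powr (s + 1)"
    using norm_powr_real_powr'[of "of_real s + 1"] by simp
  also have "(cmod (1 - z) powr (s + 1))\<^sup>2 = cmod (1 - z) powr (2 * s + 2)"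
    by (simp add: power2_eq_square flip: powr_add)
  finally have den: "(1 - z) powr (of_real s + 1) * (1 - cnj z) powr (of_real s + 1)
      = of_real (cmod (1 - z) powr (2 * s + 2))" .
  have "of_real (1 - (cmod z)\<^sup>2) powr (of_real (2 * s + 1) :: complex) = of_real ((1 - (cmod z)\<^sup>2) powr (2 * s + 1))"
    using z by (intro powr_of_real) (simp add: abs_square_le_1)
  then have num: "of_real (1 - (cmod z)\<^sup>2) powr (of_real s + of_real s + 1 :: complex)
      = of_real ((1 - (cmod z)\<^sup>2) powr (2 * s + 1))"
    by (simp del: of_real_diff)
  show ?thesis
    unfolding K_ab_def den num radial_kernel_def by simp
qed

lemma K_transform_one:
  assumes z: "cmod z < 1"
  shows "K_transform (of_real s) (of_real s) (\<lambda>_. 1) z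
    = c_ab (of_real s) (of_real s) * of_real (eval_fps (hg_fps s) ((cmod z)\<^sup>2))"
proof -
  have "K_ab (of_real s) (of_real s) (z * cis (- t)) * 1
      = of_real (radial_kernel s (cnj z * cis t)) * c_ab (of_real s) (of_real s)" for t
    using z K_ab_real[of "z * cis (- t)" s] radial_kernel_cnj[of s "z * cis (- t)"]
    by (simp add: norm_mult cis_cnj)
  then have "K_transform (of_real s) (of_real s) (\<lambda>_. 1) z
     = of_real (LINT t|lebesgue_on {0..2*pi}. radial_kernel s (cnj z * cis t)) * c_ab (of_real s) (of_real s)
       / of_real (2 * pi)"
    unfolding K_transform_def by simp
  then show ?thesis
    using radial_kernel_mean[of "cnj z" s] z by simp
qed

text \<open>This reciprocity normalizes the transform of 1: its radial limit is the kernel constant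
  times \<open>gauss_const s\<close>, that is 1.\<close>

lemma c_ab_real:
  assumes "s > -1/2"
  shows "c_ab (of_real s) (of_real s) = of_real (1 / gauss_const s)"
proof -
  have "Gamma (of_real s + 1 :: complex) = of_real (Gamma (s + 1))"
    using Gamma_complex_of_real[of "s + 1"] by simp
  moreover have "Gamma (of_real s + of_real s + 1 :: complex) = of_real (Gamma (2 * s + 1))"
    using Gamma_complex_of_real[of "2 * s + 1"] by simp
  ultimately show ?thesis
    by (simp add: c_ab_def gauss_const_def power2_eq_square)
qed

lemma gauss_const_pos: "s > -1/2 \<Longrightarrow> gauss_const s > 0"
  unfolding gauss_const_def by (intro divide_pos_pos zero_less_power Gamma_real_pos) auto

text \<open>\<open>w\<close> is given by its power series, which makes its derivatives accessible;
  on the disc it agrees with the transform of 1. Both \<open>f\<close> and \<open>w\<close> are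
  constant on every circle about 0 inside their range of use, so their means do not depend on p and
  Jensen's inequality becomes an equality.\<close>

lemma extremal_function:
  fixes s p r :: real
  assumes s: "s > -1/2" and p: "1 \<le> p" and r: "0 \<le> r" "r < 1"
  defines "f \<equiv> \<lambda>_::complex. 1 :: complex"
    and "w \<equiv> radial_fun (fps_const (1 / gauss_const s) * hg_fps s) 1 0"
  shows "continuous_on (sphere 0 1) f" "Lp_norm_circle p f = 1" "in_Lp_circle p f"
    "\<forall>z\<in>ball 0 1. w z = K_transform (of_real s) (of_real s) f z"
    "solves_dirichlet (of_real s) (of_real s) f w"
    "integral_mean p r w = cmod (c_ab (of_real s) (of_real s)) * eval_fps (hg_fps s) (r\<^sup>2)"
proof -
  let ?M = "lebesgue_on {0..2*pi}"
  define c where "c = 1 / gauss_const s"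
  define G where "G = fps_const c * hg_fps s"
  have c: "c > 0" using gauss_const_pos[OF s] by (simp add: c_def)
  have G: "1 \<le> fps_conv_radius G"
    unfolding G_def by (rule conv_radius_closed) (simp_all add: hg_fps_radius)
  have evalG: "eval_fps G x = c * eval_fps (hg_fps s) x" if "\<bar>x\<bar> < 1" for x
    unfolding G_def using that less_le_trans[OF _ hg_fps_radius, of "ereal \<bar>x\<bar>" s]
    by (subst eval_fps_mult) auto
  have wz: "w z = of_real (c * eval_fps (hg_fps s) ((cmod z)\<^sup>2))" if "cmod z < 1" for z
    using that evalG[of "(cmod z)\<^sup>2"] unfolding w_def c_def[symmetric] G_def[symmetric]
    by (simp add: radial_fun_def abs_square_less_1)
  have c_ab: "c_ab (of_real s) (of_real s) = of_real c" using c_ab_real[OF s] by (simp add: c_def)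
  have [simp]: "measure ?M {0..2*pi} = 2 * pi" by (simp add: measure_restrict_space)
  show "continuous_on (sphere 0 1) f" by (simp add: f_def)
  show "Lp_norm_circle p f = 1" by (simp add: Lp_norm_circle_def f_def)
  show "in_Lp_circle p f"
    unfolding in_Lp_circle_def f_def by (auto intro!: continuous_imp_integrable_real)
  show "\<forall>z\<in>ball 0 1. w z = K_transform (of_real s) (of_real s) f z"
    unfolding f_def using wz K_transform_one[of _ s] by (auto simp: c_ab)
  have "hg_ode s G"
    using hg_ode_hg_fps[of s] unfolding hg_ode_iff G_def by (auto simp: mult.left_commute)
  then have "ab_harmonic (of_real s) (of_real s) w"
    unfolding w_def c_def[symmetric] G_def[symmetric] by (rule ab_harmonic_radial[OF _ G])
  moreover have "has_boundary_values w f"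
    unfolding has_boundary_values_def
  proof (rule uniform_limitI)
    fix e :: real assume e: "e > 0"
    have "((\<lambda>r. c * eval_fps (hg_fps s) (r\<^sup>2)) \<longlongrightarrow> c * gauss_const s) (at_left 1)"
    proof (intro tendsto_intros filterlim_compose[OF eval_hg_tendsto_gauss_const[OF s]])
      have ev: "eventually (\<lambda>r. 0 < r \<and> r < 1) (at_left (1::real))"
        using eventually_at_left_real[of 0 "1::real"] by simp
      show "filterlim (\<lambda>r::real. r\<^sup>2) (at_left 1) (at_left 1)"
        unfolding filterlim_at
      proof
        show "eventually (\<lambda>r. r\<^sup>2 \<in> {..<1} \<and> r\<^sup>2 \<noteq> 1) (at_left (1::real))"
          using ev by eventually_elim (auto simp: abs_square_less_1 abs_square_eq_1)
        have "((\<lambda>r::real. r\<^sup>2) \<longlongrightarrow> 1\<^sup>2) (at_left 1)" by (intro tendsto_intros)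
        then show "((\<lambda>r::real. r\<^sup>2) \<longlongrightarrow> 1) (at_left 1)" by simp
      qed
    qed
    then have "((\<lambda>r. c * eval_fps (hg_fps s) (r\<^sup>2)) \<longlongrightarrow> 1) (at_left 1)"
      using c by (simp add: c_def)
    from tendstoD[OF this e] eventually_at_left_real[of 0 "1::real", simplified]
    show "\<forall>\<^sub>F r in at_left 1. \<forall>\<zeta>\<in>sphere 0 1. dist (w (of_real r * \<zeta>)) (f \<zeta>) < e"
    proof eventually_elim
      case (elim r)
      show ?case
      proof
        fix \<zeta> :: complex assume "\<zeta> \<in> sphere 0 1"
        then have "cmod (of_real r * \<zeta>) = r" using elim by (simp add: norm_mult)
        then have "w (of_real r * \<zeta>) = of_real (c * eval_fps (hg_fps s) (r\<^sup>2))"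
          using wz[of "of_real r * \<zeta>"] elim by simp
        then have "dist (w (of_real r * \<zeta>)) (f \<zeta>) = dist (c * eval_fps (hg_fps s) (r\<^sup>2)) 1"
          unfolding f_def using dist_of_real[where 'a = complex, of _ 1] by (simp del: of_real_mult)
        then show "dist (w (of_real r * \<zeta>)) (f \<zeta>) < e" using elim by simp
      qed
    qed
  qed
  ultimately show "solves_dirichlet (of_real s) (of_real s) f w"
    by (simp add: solves_dirichlet_def)
  have r2: "0 \<le> r\<^sup>2" "r\<^sup>2 < 1" using r by (simp_all add: abs_square_less_1)
  have pos: "eval_fps (hg_fps s) (r\<^sup>2) > 0" using r2 by (rule eval_hg_pos)
  have "cmod (w (of_real r * cis t)) = c * eval_fps (hg_fps s) (r\<^sup>2)" for t
    using wz[of "of_real r * cis t"] r pos c by (simp add: norm_mult)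
  then have "integral_mean p r w = c * eval_fps (hg_fps s) (r\<^sup>2)"
    using pos c p by (simp add: integral_mean_def powr_powr)
  then show "integral_mean p r w = cmod (c_ab (of_real s) (of_real s)) * eval_fps (hg_fps s) (r\<^sup>2)"
    using c by (simp add: c_ab)
qed

theorem theorem1:
  fixes \<alpha> \<beta> :: complex and p r :: real
  assumes "\<alpha> \<notin> negative_integers" and "\<beta> \<notin> negative_integers"
    and "Re (\<alpha> + \<beta>) > -1"
    and "1 \<le> p" and "0 \<le> r" and "r < 1"
  shows
    "(\<forall>f w. in_Lp_circle p f \<and> (\<forall>z\<in>ball 0 1. w z = K_transform \<alpha> \<beta> f z) \<and>
        solves_dirichlet \<alpha> \<beta> f w \<longrightarrow>
        integral_mean p r w
          \<le> cmod (c_ab \<alpha> \<beta>) * exp (pi / 2 * \<bar>Im (\<alpha> - \<beta>)\<bar>)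
             * hyp2F1 (- (Re (\<alpha> + \<beta>) / 2)) (- (Re (\<alpha> + \<beta>) / 2)) 1 (r\<^sup>2) * Lp_norm_circle p f \<and>
        integral_mean p r w
          \<le> cmod (c_ab \<alpha> \<beta>) * exp (pi / 2 * \<bar>Im (\<alpha> - \<beta>)\<bar>) * B_ab \<alpha> \<beta> * Lp_norm_circle p f) \<and>
     (\<alpha> = \<beta> \<and> \<alpha> \<in> \<real> \<longrightarrow>
        (\<exists>f w. continuous_on (sphere 0 1) f \<and> Lp_norm_circle p f > 0 \<and>
          in_Lp_circle p f \<and> (\<forall>z\<in>ball 0 1. w z = K_transform \<alpha> \<beta> f z) \<and>
          solves_dirichlet \<alpha> \<beta> f w \<and>
          integral_mean p r w
            = cmod (c_ab \<alpha> \<beta>) * exp (pi / 2 * \<bar>Im (\<alpha> - \<beta>)\<bar>)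
               * hyp2F1 (- (Re (\<alpha> + \<beta>) / 2)) (- (Re (\<alpha> + \<beta>) / 2)) 1 (r\<^sup>2) * Lp_norm_circle p f))"
proof (intro conjI allI impI)
  define s where "s = Re (\<alpha> + \<beta>) / 2"
  have s: "s > - 1 / 2" using assms(3) by (simp add: s_def)
  have B: "B_ab \<alpha> \<beta> = gauss_const s" by (simp add: B_ab_def gauss_const_def s_def del: plus_complex.sel)
  have F: "hyp2F1 (- (Re (\<alpha> + \<beta>) / 2)) (- (Re (\<alpha> + \<beta>) / 2)) 1 (r\<^sup>2) = eval_fps (hg_fps s) (r\<^sup>2)"
    unfolding s_def[symmetric] by (rule hyp2F1_eq_eval)
  let ?C = "cmod (c_ab \<alpha> \<beta>) * exp (pi / 2 * \<bar>Im (\<alpha> - \<beta>)\<bar>)"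
  {
    fix f w
    assume fw: "in_Lp_circle p f \<and> (\<forall>z\<in>ball 0 1. w z = K_transform \<alpha> \<beta> f z) \<and> solves_dirichlet \<alpha> \<beta> f w"
    show bound: "integral_mean p r w \<le> ?C
        * hyp2F1 (- (Re (\<alpha> + \<beta>) / 2)) (- (Re (\<alpha> + \<beta>) / 2)) 1 (r\<^sup>2) * Lp_norm_circle p f"
      unfolding F s_def
      by (rule K_transform_mean_bound) (use fw s assms in \<open>auto simp: s_def\<close>)
    have "eval_fps (hg_fps s) (r\<^sup>2) \<le> gauss_const s"
      using assms by (intro eval_hg_le_gauss_const s) (simp_all add: abs_square_less_1)
    then have "?C * eval_fps (hg_fps s) (r\<^sup>2) * Lp_norm_circle p f \<le> ?C * gauss_const s * Lp_norm_circle p f"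
      by (intro mult_right_mono mult_left_mono) (auto simp: Lp_norm_circle_def)
    then show "integral_mean p r w \<le> ?C * B_ab \<alpha> \<beta> * Lp_norm_circle p f"
      using bound unfolding B F by linarith
  }
  assume "\<alpha> = \<beta> \<and> \<alpha> \<in> \<real>"
  \<comment> \<open>Equal real parameters coincide with half their sum, and the exponential factor
    becomes 1.\<close>
  then have ab: "\<alpha> = of_real s" "\<beta> = of_real s" by (auto simp: s_def elim!: Reals_cases)
  show "\<exists>f w. continuous_on (sphere 0 1) f \<and> Lp_norm_circle p f > 0 \<and>
          in_Lp_circle p f \<and> (\<forall>z\<in>ball 0 1. w z = K_transform \<alpha> \<beta> f z) \<and>
          solves_dirichlet \<alpha> \<beta> f w \<and>
          integral_mean p r w
            = ?C * hyp2F1 (- (Re (\<alpha> + \<beta>) / 2)) (- (Re (\<alpha> + \<beta>) / 2)) 1 (r\<^sup>2) * Lp_norm_circle p f"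
    using extremal_function[OF s assms(4-6)] unfolding F unfolding ab
    by (intro exI[of _ "\<lambda>_. 1"] exI[of _ "radial_fun (fps_const (1 / gauss_const s) * hg_fps s) 1 0"]) simp
qed

end
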